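(* Let $(X,\Sigma,\mu)$ be a complete $\sigma$-finite measure space, $\mathcal{A}\subseteq\Sigma$ a sub-$\sigma$-finite algebra, $E=E^{\mathcal{A}}$ the associated conditional expectation, and $u,w\in\mathcal{D}(E)$ such that $T=M_wEM_u$ is a bounded operator on $L^2(\Sigma)$. If $T$ belongs to the quasi-$\ast$-$A$-class, then $\sigma_p(M_wEM_u)=\sigma_{jp}(M_wEM_u)$.
   Context: For a sub-$\sigma$-finite algebra $\mathcal{A}\subseteq\Sigma$, $E=E^{\mathcal{A}}$ denotes the conditional expectation: for $f\geq 0$ measurable or $f\in L^2(\Sigma)$, $Ef$ is the unique $\mathcal{A}$-measurable function with $\int_A f\,d\mu=\int_A Ef\,d\mu$ for all $A\in\mathcal{A}$. $\mathcal{D}(E)=\{g\in L^0(\Sigma): E(|g|)\in L^0(\mathcal{A})\}$, where $L^0$ denotes a.e. finite measurable functions. $M_w$ is multiplication by $w$, so $M_wEM_u f=wE(uf)$. For a bounded operator $T$, $|T|=(T^*T)^{1/2}$; $T$ belongs to the quasi-$\ast$-$A$-class if $T^*|T^2|T\geq T^*|T^*|^2T$. $\sigma_p(T)$ is the set of $\lambda\in\mathbb{C}$ with a unit vector $x$ such that $(T-\lambda)x=0$; $\sigma_{jp}(T)$ (joint point spectrum) is the set of $\lambda$ with a unit vector $x$ such that $(T-\lambda)x=0$ and $(T^*-\bar\lambda)x=0$. *)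

theory Defs
  imports "HOL-Probability.Probability"
begin

text \<open>Complex L^2(Sigma), represented by square-integrable measurable functions;
  elements of L^2 are identified up to equality almost everywhere.\<close>

definition L2 :: "'a measure \<Rightarrow> ('a \<Rightarrow> complex) set" where
  "L2 M = {f. f \<in> borel_measurable M \<and> integrable M (\<lambda>x. (cmod (f x))\<^sup>2)}"

definition l2_inner :: "'a measure \<Rightarrow> ('a \<Rightarrow> complex) \<Rightarrow> ('a \<Rightarrow> complex) \<Rightarrow> complex" where
  "l2_inner M f g = (\<integral>x. f x * cnj (g x) \<partial>M)"

definition l2_norm :: "'a measure \<Rightarrow> ('a \<Rightarrow> complex) \<Rightarrow> real" where
  "l2_norm M f = sqrt (\<integral>x. (cmod (f x))\<^sup>2 \<partial>M)"

definition ae_eq :: "'a measure \<Rightarrow> ('a \<Rightarrow> complex) \<Rightarrow> ('a \<Rightarrow> complex) \<Rightarrow> bool" where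
  "ae_eq M f g \<longleftrightarrow> (AE x in M. f x = g x)"

text \<open>Conditional expectation E^A (A given as the sub-sigma-algebra F) of a complex
  function: E g = E((Re g)^+) - E((Re g)^-) + i (E((Im g)^+) - E((Im g)^-)),
  where real_cond_exp is exactly E(h^+) - E(h^-) built from nn_cond_exp.\<close>

definition cond_exp_c :: "'a measure \<Rightarrow> 'a measure \<Rightarrow> ('a \<Rightarrow> complex) \<Rightarrow> ('a \<Rightarrow> complex)" where
  "cond_exp_c M F g = (\<lambda>x. Complex (real_cond_exp M F (\<lambda>y. Re (g y)) x)
                                   (real_cond_exp M F (\<lambda>y. Im (g y)) x))"

text \<open>D(E) = {g in L^0(Sigma). E(|g|) in L^0(A)}, i.e. E(|g|) finite a.e.\<close>

definition dom_E :: "'a measure \<Rightarrow> 'a measure \<Rightarrow> ('a \<Rightarrow> complex) set" where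
  "dom_E M F = {g. g \<in> borel_measurable M \<and>
                   (AE x in M. nn_cond_exp M F (\<lambda>y. ennreal (cmod (g y))) x < \<infinity>)}"

definition wce_op :: "'a measure \<Rightarrow> 'a measure \<Rightarrow> ('a \<Rightarrow> complex) \<Rightarrow> ('a \<Rightarrow> complex)
                      \<Rightarrow> ('a \<Rightarrow> complex) \<Rightarrow> ('a \<Rightarrow> complex)" where
  "wce_op M F w u f = (\<lambda>x. w x * cond_exp_c M F (\<lambda>y. u y * f y) x)"

definition bounded_op :: "'a measure \<Rightarrow> (('a \<Rightarrow> complex) \<Rightarrow> ('a \<Rightarrow> complex)) \<Rightarrow> bool" where
  "bounded_op M T \<longleftrightarrow>
     (\<forall>f\<in>L2 M. T f \<in> L2 M) \<and>
     (\<forall>f\<in>L2 M. \<forall>g\<in>L2 M. \<forall>a b. ae_eq M (T (\<lambda>x. a * f x + b * g x)) (\<lambda>x. a * T f x + b * T g x)) \<and>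
     (\<exists>C. \<forall>f\<in>L2 M. l2_norm M (T f) \<le> C * l2_norm M f)"

text \<open>Hilbert-space adjoint T^* (unique up to a.e. equality on L^2).\<close>

definition is_adjoint :: "'a measure \<Rightarrow> (('a \<Rightarrow> complex) \<Rightarrow> ('a \<Rightarrow> complex))
                          \<Rightarrow> (('a \<Rightarrow> complex) \<Rightarrow> ('a \<Rightarrow> complex)) \<Rightarrow> bool" where
  "is_adjoint M T S \<longleftrightarrow> (\<forall>g\<in>L2 M. S g \<in> L2 M) \<and>
     (\<forall>f\<in>L2 M. \<forall>g\<in>L2 M. l2_inner M (T f) g = l2_inner M f (S g))"

definition adj :: "'a measure \<Rightarrow> (('a \<Rightarrow> complex) \<Rightarrow> ('a \<Rightarrow> complex))
                   \<Rightarrow> (('a \<Rightarrow> complex) \<Rightarrow> ('a \<Rightarrow> complex))" where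
  "adj M T = (SOME S. is_adjoint M T S)"

definition op_le :: "'a measure \<Rightarrow> (('a \<Rightarrow> complex) \<Rightarrow> ('a \<Rightarrow> complex))
                     \<Rightarrow> (('a \<Rightarrow> complex) \<Rightarrow> ('a \<Rightarrow> complex)) \<Rightarrow> bool" where
  "op_le M A B \<longleftrightarrow> (\<forall>f\<in>L2 M.
      Im (l2_inner M (B f) f - l2_inner M (A f) f) = 0 \<and>
      Re (l2_inner M (B f) f - l2_inner M (A f) f) \<ge> 0)"

definition positive_op :: "'a measure \<Rightarrow> (('a \<Rightarrow> complex) \<Rightarrow> ('a \<Rightarrow> complex)) \<Rightarrow> bool" where
  "positive_op M A \<longleftrightarrow> op_le M (\<lambda>f x. 0) A"

text \<open>|T| = (T^* T)^{1/2}: the (unique) positive bounded square root of T^* T.\<close>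

definition op_abs :: "'a measure \<Rightarrow> (('a \<Rightarrow> complex) \<Rightarrow> ('a \<Rightarrow> complex))
                      \<Rightarrow> (('a \<Rightarrow> complex) \<Rightarrow> ('a \<Rightarrow> complex))" where
  "op_abs M T = (SOME R. bounded_op M R \<and> positive_op M R \<and>
                   (\<forall>f\<in>L2 M. ae_eq M (R (R f)) (adj M T (T f))))"

definition quasi_star_A :: "'a measure \<Rightarrow> (('a \<Rightarrow> complex) \<Rightarrow> ('a \<Rightarrow> complex)) \<Rightarrow> bool" where
  "quasi_star_A M T \<longleftrightarrow>
     op_le M (\<lambda>f. adj M T (op_abs M (adj M T) (op_abs M (adj M T) (T f))))
             (\<lambda>f. adj M T (op_abs M (\<lambda>g. T (T g)) (T f)))"

definition point_spectrum :: "'a measure \<Rightarrow> (('a \<Rightarrow> complex) \<Rightarrow> ('a \<Rightarrow> complex)) \<Rightarrow> complex set" where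
  "point_spectrum M T = {c. \<exists>x\<in>L2 M. l2_norm M x = 1 \<and> ae_eq M (T x) (\<lambda>t. c * x t)}"

definition joint_point_spectrum :: "'a measure \<Rightarrow> (('a \<Rightarrow> complex) \<Rightarrow> ('a \<Rightarrow> complex)) \<Rightarrow> complex set" where
  "joint_point_spectrum M T = {c. \<exists>x\<in>L2 M. l2_norm M x = 1 \<and>
      ae_eq M (T x) (\<lambda>t. c * x t) \<and> ae_eq M (adj M T x) (\<lambda>t. cnj c * x t)}"

end

theory Submission
  imports Defs
begin

text \<open>
  On the set \<open>Z\<close> where both \<open>E(|u|\<^sup>2)\<close> and \<open>E(|w|\<^sup>2)\<close> are positive and finite, normalise \<open>v = u / E(|u|\<^sup>2)\<^sup>1\<^sup>/\<^sup>2\<close>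
  and \<open>z = w / E(|w|\<^sup>2)\<^sup>1\<^sup>/\<^sup>2\<close>. Boundedness of \<open>T\<close> forces \<open>E(|u|\<^sup>2) E(|w|\<^sup>2)\<close> to be essentially bounded and
  \<open>T f = k z E(v f)\<close> with \<open>k = (E(|u|\<^sup>2) E(|w|\<^sup>2))\<^sup>1\<^sup>/\<^sup>2\<close> on \<open>Z\<close> and \<open>k = 0\<close> elsewhere. Operators of this shape are closed
  under composition and adjoints and have explicit square roots, so \<open>T\<^sup>*\<close>, \<open>|T\<^sup>*|\<close> and \<open>|T\<^sup>2|\<close> exist.
  The quasi-*-A inequality at \<open>f\<close>, combined with Cauchy-Schwarz, gives
  \<open>\<parallel>T\<^sup>* T f\<parallel>\<^sup>2 \<le> \<parallel>T\<^sup>3 f\<parallel> \<parallel>T f\<parallel>\<close>. Testing it on \<open>f = cnj v \<cdot> 1\<^sub>A\<close> with \<open>A \<in> \<A>\<close> yields \<open>|E(v z)| = 1\<close> on \<open>Z\<close>,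
  which is equality in the conditional Cauchy-Schwarz inequality, so \<open>z = c cnj v\<close> for \<open>c = E(v z)\<close>.
  Thus \<open>T f = k c cnj v E(v f)\<close> is normal, and eigenvectors of \<open>T\<close> are eigenvectors of \<open>T\<^sup>*\<close>
  for the conjugate eigenvalue (including the eigenvalue \<open>0\<close>).
\<close>

section \<open>Conditional expectation of complex functions\<close>

context sigma_finite_subalgebra
begin

lemma F_imp_M: "h \<in> borel_measurable F \<Longrightarrow> h \<in> borel_measurable M"
  by (rule measurable_from_subalg[OF subalg])

lemma sets_F_imp_M: "A \<in> sets F \<Longrightarrow> A \<in> sets M"
  using subalg by (auto simp: subalgebra_def)

lemma space_F: "space F = space M"
  using subalg by (simp add: subalgebra_def)

lemma cond_exp_c_measurable [measurable]:
  "cond_exp_c M F g \<in> borel_measurable F" "cond_exp_c M F g \<in> borel_measurable M"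
  by (simp_all add: borel_measurable_complex_iff cond_exp_c_def)

text \<open>Sigma-finiteness of the measure restricted to \<open>F\<close>, read in
  \<open>M\<close>. Statements that hold almost everywhere are later proved on each
  \<open>B n\<close>, where indicators belong to \<open>L2\<close>, and then glued over
  \<open>n\<close>.\<close>

lemma finite_exhaustion:
  "\<exists>B :: nat \<Rightarrow> 'a set. (\<forall>n. B n \<in> sets F \<and> emeasure M (B n) < \<infinity>) \<and> space M \<subseteq> (\<Union>n. B n)"
proof -
  interpret R: sigma_finite_measure "restr_to_subalg M F" by (rule sigma_fin_subalg)
  obtain B :: "nat \<Rightarrow> 'a set" where B: "range B \<subseteq> sets (restr_to_subalg M F)"
    "(\<Union>i. B i) = space (restr_to_subalg M F)" "\<And>i. emeasure (restr_to_subalg M F) (B i) \<noteq> \<infinity>"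
    using R.sigma_finite by metis
  have F: "B n \<in> sets F" for n
    using B(1) sets_restr_to_subalg[OF subalg] by auto
  have "emeasure M (B n) < \<infinity>" for n
    using B(3)[of n] emeasure_restr_to_subalg[OF subalg F] by (simp add: less_top)
  with F B(2) show ?thesis
    by (intro exI[of _ B]) (auto simp: space_restr_to_subalg)
qed

text \<open>The library computes with \<open>real_cond_exp\<close> for integrable functions only; cutting \<open>g\<close> down to these
  sets extends the calculus to \<open>dom_E\<close>.\<close>

lemma dom_E_localize:
  assumes "g \<in> dom_E M F"
  shows "\<exists>A :: nat \<Rightarrow> 'a set. (\<forall>n. A n \<in> sets F \<and> integrable M (\<lambda>x. indicator (A n) x * g x))
    \<and> (AE x in M. \<exists>n. x \<in> A n)"
proof -
  have [measurable]: "g \<in> borel_measurable M"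
    and fin: "AE x in M. nn_cond_exp M F (\<lambda>y. ennreal (cmod (g y))) x < \<infinity>"
    using assms by (auto simp: dom_E_def)
  define N where "N = nn_cond_exp M F (\<lambda>y. ennreal (cmod (g y)))"
  have [measurable]: "N \<in> borel_measurable F" "N \<in> borel_measurable M" by (simp_all add: N_def)
  obtain B :: "nat \<Rightarrow> 'a set" where B: "\<And>n. B n \<in> sets F" "\<And>n. emeasure M (B n) < \<infinity>"
    "space M \<subseteq> (\<Union>n. B n)"
    using finite_exhaustion by blast
  note [measurable] = B(1)
  \<comment> \<open>Below level \<open>j\<close> of E(|g|) and inside \<open>B i\<close>, the
    integral of |g| equals that of E(|g|), hence is at most \<open>j\<close> times the measure of
    \<open>B i\<close>. Since E(|g|) is finite almost everywhere, these sets exhaust the space;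
    \<open>prod_decode\<close> later merges the two indices.\<close>
  define C where "C i j = {x \<in> B i. N x \<le> of_nat j}" for i j :: nat
  have C [measurable]: "C i j \<in> sets F" for i j unfolding C_def by measurable
  have CM [measurable]: "C i j \<in> sets M" for i j using C sets_F_imp_M by blast
  have BM [measurable]: "B i \<in> sets M" for i using B sets_F_imp_M by blast
  have int: "integrable M (\<lambda>x. indicator (C i j) x * g x)" for i j
  proof (rule integrableI_bounded)
    have "(\<integral>\<^sup>+ x. ennreal (norm (indicator (C i j) x * g x)) \<partial>M)
        = (\<integral>\<^sup>+ x. indicator (C i j) x * ennreal (cmod (g x)) \<partial>M)"
      by (intro nn_integral_cong) (auto simp: indicator_def)
    also have "\<dots> = (\<integral>\<^sup>+ x. indicator (C i j) x * N x \<partial>M)"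
      unfolding N_def by (rule nn_cond_exp_intg[symmetric]) auto
    also have "\<dots> \<le> (\<integral>\<^sup>+ x. of_nat j * indicator (B i) x \<partial>M)"
      by (intro nn_integral_mono) (auto simp: indicator_def C_def)
    also have "\<dots> = of_nat j * emeasure M (B i)"
      by (simp add: nn_integral_cmult)
    also have "\<dots> < \<infinity>"
      using B(2)[of i] by (simp add: ennreal_mult_less_top of_nat_less_top)
    finally show "(\<integral>\<^sup>+ x. ennreal (norm (indicator (C i j) x * g x)) \<partial>M) < \<infinity>" .
  qed measurable
  have cov: "AE x in M. \<exists>n. x \<in> C (fst (prod_decode n)) (snd (prod_decode n))"
    using fin AE_space
  proof eventually_elim
    fix x assume xs: "x \<in> space M" and "nn_cond_exp M F (\<lambda>y. ennreal (cmod (g y))) x < \<infinity>"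
    then obtain j :: nat where j: "N x < of_nat j"
      unfolding N_def using ennreal_Ex_less_of_nat by (metis infinity_ennreal_def)
    obtain i where "x \<in> B i" using B(3) xs by blast
    then have "x \<in> C i j" using j by (simp add: C_def)
    then show "\<exists>n. x \<in> C (fst (prod_decode n)) (snd (prod_decode n))"
      by (intro exI[of _ "prod_encode (i, j)"]) simp
  qed
  show ?thesis
    using C int cov by (intro exI[of _ "\<lambda>n. C (fst (prod_decode n)) (snd (prod_decode n))"]) blast
qed

text \<open>The domination is only required almost everywhere, so this also carries membership over
  to any representative that is equal almost everywhere.\<close>

lemma dom_E_mono:
  assumes g: "g \<in> dom_E M F" and [measurable]: "g' \<in> borel_measurable M"
    and le: "AE x in M. cmod (g' x) \<le> cmod (g x)"
  shows "g' \<in> dom_E M F"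
proof -
  have [measurable]: "g \<in> borel_measurable M"
    and fin: "AE x in M. nn_cond_exp M F (\<lambda>y. ennreal (cmod (g y))) x < \<infinity>"
    using g by (auto simp: dom_E_def)
  have "AE x in M. nn_cond_exp M F (\<lambda>y. ennreal (cmod (g' y))) x
      \<le> nn_cond_exp M F (\<lambda>y. ennreal (cmod (g y))) x"
    by (rule nn_cond_exp_mono) (use le in \<open>auto simp: ennreal_leI\<close>)
  with fin have "AE x in M. nn_cond_exp M F (\<lambda>y. ennreal (cmod (g' y))) x < \<infinity>"
    by eventually_elim (rule le_less_trans)
  then show ?thesis by (simp add: dom_E_def)
qed

lemma cond_exp_c_cong:
  assumes "AE x in M. f x = g x" "f \<in> borel_measurable M" "g \<in> borel_measurable M"
  shows "AE x in M. cond_exp_c M F f x = cond_exp_c M F g x"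
proof -
  have [measurable]: "f \<in> borel_measurable M" "g \<in> borel_measurable M" by fact+
  have "AE x in M. real_cond_exp M F (\<lambda>y. Re (f y)) x = real_cond_exp M F (\<lambda>y. Re (g y)) x"
    "AE x in M. real_cond_exp M F (\<lambda>y. Im (f y)) x = real_cond_exp M F (\<lambda>y. Im (g y)) x"
    using assms(1) by (intro real_cond_exp_cong; force)+
  then show ?thesis unfolding cond_exp_c_def by eventually_elim simp
qed

lemma cond_exp_c_cnj: "cond_exp_c M F (\<lambda>x. cnj (g x)) x = cnj (cond_exp_c M F g x)"
  by (simp add: cond_exp_c_def real_cond_exp_def complex_eq_iff)

text \<open>Expanding into real and imaginary parts leaves four real products, each dominated by |h
  g| and hence integrable, so the real pull-out rule applies to each.\<close>

lemma cond_exp_c_mult_integrable: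
  assumes h: "h \<in> borel_measurable F" and g: "g \<in> borel_measurable M"
    and int: "integrable M (\<lambda>x. h x * g x)"
  shows "AE x in M. cond_exp_c M F (\<lambda>x. h x * g x) x = h x * cond_exp_c M F g x"
proof -
  note [measurable] = h g
  have [measurable]: "h \<in> borel_measurable M" by (rule F_imp_M[OF h])
  have i: "integrable M (\<lambda>x. Re (h x) * Re (g x))" "integrable M (\<lambda>x. Im (h x) * Im (g x))"
    "integrable M (\<lambda>x. Re (h x) * Im (g x))" "integrable M (\<lambda>x. Im (h x) * Re (g x))"
    by (rule Bochner_Integration.integrable_bound[OF int],
        simp, rule AE_I2, simp add: norm_mult abs_mult abs_Re_le_cmod abs_Im_le_cmod mult_mono)+
  have m: "(\<lambda>x. Re (h x)) \<in> borel_measurable F" "(\<lambda>x. Im (h x)) \<in> borel_measurable F"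
    "(\<lambda>x. Re (g x)) \<in> borel_measurable M" "(\<lambda>x. Im (g x)) \<in> borel_measurable M"
    by measurable
  have r: "AE x in M. real_cond_exp M F (\<lambda>x. Re (h x) * Re (g x)) x = Re (h x) * real_cond_exp M F (\<lambda>x. Re (g x)) x"
    "AE x in M. real_cond_exp M F (\<lambda>x. Im (h x) * Im (g x)) x = Im (h x) * real_cond_exp M F (\<lambda>x. Im (g x)) x"
    "AE x in M. real_cond_exp M F (\<lambda>x. Re (h x) * Im (g x)) x = Re (h x) * real_cond_exp M F (\<lambda>x. Im (g x)) x"
    "AE x in M. real_cond_exp M F (\<lambda>x. Im (h x) * Re (g x)) x = Im (h x) * real_cond_exp M F (\<lambda>x. Re (g x)) x"
    by (rule real_cond_exp_mult; use m i in blast)+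
  show ?thesis
    unfolding cond_exp_c_def times_complex.sel
    using r real_cond_exp_diff[OF i(1,2)] real_cond_exp_add[OF i(3,4)]
    by eventually_elim (simp add: complex_eq_iff)
qed

text \<open>On each localizing set the integrable function
  \<open>indicator (A n) x * (h x * g x)\<close> splits in two ways, pulling out either
  \<open>indicator (A n)\<close> or \<open>indicator (A n) * h\<close>. Comparing the two results on
  \<open>A n\<close> gives the claim.\<close>

lemma cond_exp_c_mult:
  assumes h [measurable]: "h \<in> borel_measurable F" and g [measurable]: "g \<in> borel_measurable M"
    and dom: "(\<lambda>x. h x * g x) \<in> dom_E M F"
  shows "AE x in M. cond_exp_c M F (\<lambda>x. h x * g x) x = h x * cond_exp_c M F g x"
proof -
  obtain A :: "nat \<Rightarrow> 'a set" where A [measurable]: "\<And>n. A n \<in> sets F"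
    and int: "\<And>n. integrable M (\<lambda>x. indicator (A n) x * (h x * g x))"
    and cov: "AE x in M. \<exists>n. x \<in> A n"
    using dom_E_localize[OF dom] by blast
  have hM [measurable]: "h \<in> borel_measurable M" by (rule F_imp_M[OF h])
  have m: "(indicator (A n) :: 'a \<Rightarrow> complex) \<in> borel_measurable F"
    "(\<lambda>x. indicator (A n) x * h x) \<in> borel_measurable F" "(\<lambda>x. h x * g x) \<in> borel_measurable M" for n
    by measurable
  have "AE x in M. indicator (A n) x * cond_exp_c M F (\<lambda>x. h x * g x) x
      = indicator (A n) x * (h x * cond_exp_c M F g x)" for n
    using cond_exp_c_mult_integrable[OF m(1,3) int[of n]]
      cond_exp_c_mult_integrable[OF m(2)[of n] g int[of n, folded mult.assoc]]
    by eventually_elim (simp only: mult.assoc)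
  then have "AE x in M. \<forall>n. indicator (A n) x * cond_exp_c M F (\<lambda>x. h x * g x) x
      = indicator (A n) x * (h x * cond_exp_c M F g x)"
    unfolding AE_all_countable by blast
  with cov show ?thesis
    by eventually_elim (auto simp: indicator_def split: if_splits)
qed

text \<open>\<open>f\<close> and \<open>g\<close> come with different localizing sequences. On the
  intersections \<open>A i\<close> with \<open>B j\<close> both are integrable, and these still
  cover almost every point.\<close>

lemma cond_exp_c_add:
  assumes f: "f \<in> dom_E M F" and g: "g \<in> dom_E M F"
  shows "AE x in M. cond_exp_c M F (\<lambda>x. f x + g x) x = cond_exp_c M F f x + cond_exp_c M F g x"
proof -
  have [measurable]: "f \<in> borel_measurable M" "g \<in> borel_measurable M"
    using f g by (auto simp: dom_E_def)
  obtain A :: "nat \<Rightarrow> 'a set" where A [measurable]: "\<And>n. A n \<in> sets F"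
    and intA: "\<And>n. integrable M (\<lambda>x. indicator (A n) x * f x)"
    and covA: "AE x in M. \<exists>n. x \<in> A n"
    using dom_E_localize[OF f] by blast
  obtain B :: "nat \<Rightarrow> 'a set" where B [measurable]: "\<And>n. B n \<in> sets F"
    and intB: "\<And>n. integrable M (\<lambda>x. indicator (B n) x * g x)"
    and covB: "AE x in M. \<exists>n. x \<in> B n"
    using dom_E_localize[OF g] by blast
  have [measurable]: "A n \<in> sets M" "B n \<in> sets M" for n using A B sets_F_imp_M by blast+
  have *: "AE x in M. indicator (A i \<inter> B j) x * cond_exp_c M F (\<lambda>x. f x + g x) x
     = indicator (A i \<inter> B j) x * (cond_exp_c M F f x + cond_exp_c M F g x)" for i j
  proof -
    let ?I = "indicator (A i \<inter> B j) :: 'a \<Rightarrow> complex"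
    have i: "integrable M (\<lambda>x. ?I x * f x)"
      by (rule Bochner_Integration.integrable_bound[OF intA[of i]]) (auto simp: indicator_def norm_mult)
    have j: "integrable M (\<lambda>x. ?I x * g x)"
      by (rule Bochner_Integration.integrable_bound[OF intB[of j]]) (auto simp: indicator_def norm_mult)
    have ij: "integrable M (\<lambda>x. ?I x * (f x + g x))"
      using Bochner_Integration.integrable_add[OF i j] by (simp add: distrib_left)
    have m: "?I \<in> borel_measurable F" "f \<in> borel_measurable M" "g \<in> borel_measurable M"
       "(\<lambda>x. f x + g x) \<in> borel_measurable M" by measurable
    have "AE x in M. cond_exp_c M F (\<lambda>x. ?I x * (f x + g x)) x
        = cond_exp_c M F (\<lambda>x. ?I x * f x) x + cond_exp_c M F (\<lambda>x. ?I x * g x) x"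
      using real_cond_exp_add[OF integrable_Re[OF i] integrable_Re[OF j]]
        real_cond_exp_add[OF integrable_Im[OF i] integrable_Im[OF j]]
      unfolding cond_exp_c_def distrib_left plus_complex.sel
      by eventually_elim (simp add: complex_eq_iff)
    with cond_exp_c_mult_integrable[OF m(1,4) ij] cond_exp_c_mult_integrable[OF m(1,2) i]
      cond_exp_c_mult_integrable[OF m(1,3) j]
    show ?thesis by eventually_elim (simp add: distrib_left)
  qed
  then have "AE x in M. \<forall>i j. indicator (A i \<inter> B j) x * cond_exp_c M F (\<lambda>x. f x + g x) x
     = indicator (A i \<inter> B j) x * (cond_exp_c M F f x + cond_exp_c M F g x)"
    unfolding AE_all_countable by blast
  with covA covB show ?thesis
    by eventually_elim (auto simp: indicator_def split: if_splits)
qed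

lemma cond_exp_c_integral:
  assumes "integrable M g"
  shows "integrable M (cond_exp_c M F g)" "(\<integral>x. cond_exp_c M F g x \<partial>M) = (\<integral>x. g x \<partial>M)"
proof -
  have r: "integrable M (\<lambda>x. real_cond_exp M F (\<lambda>y. Re (g y)) x)" "integrable M (\<lambda>x. real_cond_exp M F (\<lambda>y. Im (g y)) x)"
    using assms by (auto intro!: real_cond_exp_int(1))
  then have "integrable M (\<lambda>x. complex_of_real (real_cond_exp M F (\<lambda>y. Re (g y)) x)
      + \<i> * complex_of_real (real_cond_exp M F (\<lambda>y. Im (g y)) x))"
    by (intro Bochner_Integration.integrable_add integrable_mult_right integrable_of_real)
  then show int: "integrable M (cond_exp_c M F g)"
    by (simp add: cond_exp_c_def Complex_eq)
  have "Re (\<integral>x. cond_exp_c M F g x \<partial>M) = Re (\<integral>x. g x \<partial>M)"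
    unfolding integral_Re[OF int, symmetric] integral_Re[OF assms, symmetric]
    by (simp add: cond_exp_c_def real_cond_exp_int(2) assms)
  moreover have "Im (\<integral>x. cond_exp_c M F g x \<partial>M) = Im (\<integral>x. g x \<partial>M)"
    unfolding integral_Im[OF int, symmetric] integral_Im[OF assms, symmetric]
    by (simp add: cond_exp_c_def real_cond_exp_int(2) assms)
  ultimately show "(\<integral>x. cond_exp_c M F g x \<partial>M) = (\<integral>x. g x \<partial>M)"
    by (simp add: complex_eq_iff)
qed

text \<open>The negative part of \<open>r\<close> is zero, so only the first term of
  \<open>real_cond_exp\<close> survives. Where the conditional expectation is infinite,
  \<open>enn2real\<close> makes both sides 0.\<close>

lemma cond_exp_c_of_real:
  assumes [measurable]: "r \<in> borel_measurable M" and nonneg: "\<And>x. 0 \<le> r x"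
  shows "AE x in M. cond_exp_c M F (\<lambda>x. of_real (r x)) x
    = of_real (enn2real (nn_cond_exp M F (\<lambda>x. ennreal (r x)) x))"
proof -
  have z: "(\<lambda>x. ennreal (- r x)) = (\<lambda>x. 0)" using nonneg by (auto simp: ennreal_neg)
  have "AE x in M. 0 = nn_cond_exp M F (\<lambda>x. 0) x"
    by (rule nn_cond_exp_F_meas) simp
  then show ?thesis
    by eventually_elim (simp add: cond_exp_c_def real_cond_exp_def z complex_eq_iff)
qed

text \<open>Multiplying by an \<open>F\<close>-measurable phase turns |E g| into E(Re (t g)), and Re
  (t g) is at most |g|.\<close>

lemma cond_exp_c_norm_le:
  assumes g: "g \<in> dom_E M F"
  shows "AE x in M. ennreal (cmod (cond_exp_c M F g x)) \<le> nn_cond_exp M F (\<lambda>x. ennreal (cmod (g x))) x"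
proof -
  have [measurable]: "g \<in> borel_measurable M" using g by (auto simp: dom_E_def)
  \<comment> \<open>\<open>t\<close> is the phase with \<open>t \<cdot> E g = |E g|\<close>; it is \<open>0\<close> where \<open>E g = 0\<close>.\<close>
  define t where "t x = cnj (cond_exp_c M F g x) / of_real (cmod (cond_exp_c M F g x))" for x
  have t [measurable]: "t \<in> borel_measurable F"
    unfolding t_def by (intro borel_measurable_divide) (simp_all add: borel_measurable_complex_iff)
  have [measurable]: "t \<in> borel_measurable M" by (rule F_imp_M[OF t])
  have t1: "cmod (t x) \<le> 1" for x by (simp add: t_def norm_divide)
  have le: "cmod (t x * g x) \<le> cmod (g x)" for x
    using t1[of x] by (simp add: norm_mult mult_left_le_one_le)
  have "(\<lambda>x. t x * g x) \<in> dom_E M F"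
    by (rule dom_E_mono[OF g]) (use le in auto)
  then have "AE x in M. cond_exp_c M F (\<lambda>x. t x * g x) x = t x * cond_exp_c M F g x"
    by (intro cond_exp_c_mult) auto
  moreover have "AE x in M. \<bar>real_cond_exp M F (\<lambda>x. Re (t x * g x)) x\<bar>
      \<le> nn_cond_exp M F (\<lambda>x. ennreal \<bar>Re (t x * g x)\<bar>) x"
    by (rule real_cond_exp_abs) measurable
  moreover have "AE x in M. nn_cond_exp M F (\<lambda>x. ennreal \<bar>Re (t x * g x)\<bar>) x
      \<le> nn_cond_exp M F (\<lambda>x. ennreal (cmod (g x))) x"
    by (rule nn_cond_exp_mono)
      (simp_all del: times_complex.sel add: ennreal_leI order_trans[OF abs_Re_le_cmod le])
  ultimately show ?thesis
  proof eventually_elim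
    fix x
    assume 1: "cond_exp_c M F (\<lambda>x. t x * g x) x = t x * cond_exp_c M F g x"
      and 2: "ennreal \<bar>real_cond_exp M F (\<lambda>x. Re (t x * g x)) x\<bar> \<le> nn_cond_exp M F (\<lambda>x. ennreal \<bar>Re (t x * g x)\<bar>) x"
      and 3: "nn_cond_exp M F (\<lambda>x. ennreal \<bar>Re (t x * g x)\<bar>) x \<le> nn_cond_exp M F (\<lambda>x. ennreal (cmod (g x))) x"
    have "t x * cond_exp_c M F g x = of_real (cmod (cond_exp_c M F g x))"
      by (simp add: t_def complex_norm_square[symmetric] power2_eq_square mult.commute)
    then have "Re (t x * cond_exp_c M F g x) = cmod (cond_exp_c M F g x)" by simp
    then have "cmod (cond_exp_c M F g x) = real_cond_exp M F (\<lambda>x. Re (t x * g x)) x"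
      using arg_cong[OF 1, of Re] by (simp add: cond_exp_c_def del: times_complex.sel)
    then have "ennreal (cmod (cond_exp_c M F g x)) = ennreal \<bar>real_cond_exp M F (\<lambda>x. Re (t x * g x)) x\<bar>"
      by (metis abs_norm_cancel)
    then show "ennreal (cmod (cond_exp_c M F g x)) \<le> nn_cond_exp M F (\<lambda>x. ennreal (cmod (g x))) x"
      using 2 3 by (metis order_trans)
  qed
qed

end

section \<open>Weighted conditional expectation operators on L2\<close>

text \<open>Contains both \<open>L2\<close> and the normalised symbols below. A product of two
  members lies in \<open>dom_E\<close>, which is what the calculus of \<open>cond_exp_c\<close> asks
  for.\<close>

definition sq_cond_integrable :: "'a measure \<Rightarrow> 'a measure \<Rightarrow> ('a \<Rightarrow> complex) set" where
  "sq_cond_integrable M F = {f \<in> borel_measurable M.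
     AE x in M. nn_cond_exp M F (\<lambda>y. ennreal ((cmod (f y))\<^sup>2)) x < \<infinity>}"

text \<open>The unit ball of the module over the \<open>F\<close>-measurable functions with inner
  product E(f cnj g). For \<open>v\<close> in it, sending \<open>f\<close> to E(v f) is a
  contraction of \<open>L2\<close>, and multiplication by \<open>v\<close> is a contraction on the
  \<open>F\<close>-measurable part of \<open>L2\<close>.\<close>

definition cond_unit_ball :: "'a measure \<Rightarrow> 'a measure \<Rightarrow> ('a \<Rightarrow> complex) set" where
  "cond_unit_ball M F = {f \<in> borel_measurable M.
     AE x in M. nn_cond_exp M F (\<lambda>y. ennreal ((cmod (f y))\<^sup>2)) x \<le> 1}"

text \<open>The bounded scalars of that module: L-infinity over \<open>F\<close>.\<close>

definition ess_bounded :: "'a measure \<Rightarrow> 'a measure \<Rightarrow> ('a \<Rightarrow> complex) set" where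
  "ess_bounded M F = {k \<in> borel_measurable F. \<exists>K. AE x in M. cmod (k x) \<le> K}"

text \<open>With \<open>F\<close>-measurable functions as scalars this is a rank-one operator,
  \<open>z\<close> tensor \<open>cnj v\<close>, times the scalar \<open>k\<close>. With
  \<open>k\<close> kept apart from the symbols, products, adjoints and square roots can be read off
  from the coefficient and the outer symbols.\<close>

definition wop :: "'a measure \<Rightarrow> 'a measure \<Rightarrow> ('a \<Rightarrow> complex) \<Rightarrow> ('a \<Rightarrow> complex) \<Rightarrow> ('a \<Rightarrow> complex)
    \<Rightarrow> ('a \<Rightarrow> complex) \<Rightarrow> ('a \<Rightarrow> complex)" where
  "wop M F k z v f = (\<lambda>x. k x * (z x * cond_exp_c M F (\<lambda>y. v y * f y) x))"

section \<open>Elementary facts on \<open>L2\<close> and on the symbol classes\<close>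

lemma L2_iff: "f \<in> L2 M \<longleftrightarrow> f \<in> borel_measurable M \<and> (\<integral>\<^sup>+x. ennreal ((cmod (f x))\<^sup>2) \<partial>M) < \<infinity>"
  by (auto simp: L2_def integrable_iff_bounded)

lemma L2_measurable [measurable_dest]: "f \<in> L2 M \<Longrightarrow> f \<in> borel_measurable M"
  by (simp add: L2_def)

lemma L2_sq_integrable: "f \<in> L2 M \<Longrightarrow> integrable M (\<lambda>x. (cmod (f x))\<^sup>2)"
  by (simp add: L2_def)

lemma L2_nn_norm: "f \<in> L2 M \<Longrightarrow> (\<integral>\<^sup>+x. ennreal ((cmod (f x))\<^sup>2) \<partial>M) = ennreal ((l2_norm M f)\<^sup>2)"
  by (simp add: l2_norm_def L2_def nn_integral_eq_integral)

lemma l2_norm_nonneg: "0 \<le> l2_norm M f"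
  by (simp add: l2_norm_def)

lemma l2_norm_leI:
  assumes "f \<in> L2 M" "g \<in> L2 M" "0 \<le> C"
    and "(\<integral>\<^sup>+x. ennreal ((cmod (f x))\<^sup>2) \<partial>M) \<le> ennreal (C\<^sup>2) * (\<integral>\<^sup>+x. ennreal ((cmod (g x))\<^sup>2) \<partial>M)"
  shows "l2_norm M f \<le> C * l2_norm M g"
proof -
  have "ennreal ((l2_norm M f)\<^sup>2) \<le> ennreal ((C * l2_norm M g)\<^sup>2)"
    using assms(4) by (simp add: L2_nn_norm assms(1,2) power_mult_distrib ennreal_mult)
  then have "(l2_norm M f)\<^sup>2 \<le> (C * l2_norm M g)\<^sup>2"
    by (simp add: ennreal_le_iff)
  then show ?thesis
    by (rule power2_le_imp_le) (simp add: assms(3) l2_norm_nonneg)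
qed

lemma L2_dominated:
  assumes "g \<in> L2 M" "f \<in> borel_measurable M" "AE x in M. cmod (f x) \<le> C * cmod (g x)"
  shows "f \<in> L2 M"
proof -
  have "integrable M (\<lambda>x. C\<^sup>2 * (cmod (g x))\<^sup>2)"
    using assms(1) by (auto simp: L2_def)
  moreover have "AE x in M. norm ((cmod (f x))\<^sup>2) \<le> norm (C\<^sup>2 * (cmod (g x))\<^sup>2)"
    using assms(3)
  proof eventually_elim
    case (elim x)
    have "(cmod (f x))\<^sup>2 \<le> (C * cmod (g x))\<^sup>2" by (rule power_mono[OF elim]) simp
    then show ?case by (simp add: power_mult_distrib)
  qed
  moreover have "(\<lambda>x. (cmod (f x))\<^sup>2) \<in> borel_measurable M" using assms(2) by measurable
  ultimately have "integrable M (\<lambda>x. (cmod (f x))\<^sup>2)"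
    using Bochner_Integration.integrable_bound by blast
  then show ?thesis using assms(2) by (simp add: L2_def)
qed

lemma L2_scale: "f \<in> L2 M \<Longrightarrow> (\<lambda>x. a * f x) \<in> L2 M"
  by (rule L2_dominated[of f M _ "cmod a"]) (auto simp: norm_mult)

lemma L2_cnj: "f \<in> L2 M \<Longrightarrow> (\<lambda>x. cnj (f x)) \<in> L2 M"
  by (simp add: L2_def borel_measurable_complex_iff)

lemma L2_mult_integrable:
  assumes "f \<in> L2 M" "g \<in> L2 M"
  shows "integrable M (\<lambda>x. f x * g x)"
proof (rule Bochner_Integration.integrable_bound)
  show "integrable M (\<lambda>x. (cmod (f x))\<^sup>2 + (cmod (g x))\<^sup>2)"
    using assms by (auto simp: L2_def)
  show "(\<lambda>x. f x * g x) \<in> borel_measurable M" using assms by measurable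
  have "cmod (f x) * cmod (g x) \<le> (cmod (f x))\<^sup>2 + (cmod (g x))\<^sup>2" for x
    using sum_squares_bound[of "cmod (f x)" "cmod (g x)"]
      mult_nonneg_nonneg[OF norm_ge_zero[of "f x"] norm_ge_zero[of "g x"]] by linarith
  then show "AE x in M. norm (f x * g x) \<le> norm ((cmod (f x))\<^sup>2 + (cmod (g x))\<^sup>2)"
    by (simp add: norm_mult)
qed

lemma L2_add:
  assumes "f \<in> L2 M" "g \<in> L2 M"
  shows "(\<lambda>x. f x + g x) \<in> L2 M"
proof -
  have int: "integrable M (\<lambda>x. 2 * (cmod (f x))\<^sup>2 + 2 * (cmod (g x))\<^sup>2)"
    using assms by (auto simp: L2_def)
  have "(cmod (f x + g x))\<^sup>2 \<le> 2 * (cmod (f x))\<^sup>2 + 2 * (cmod (g x))\<^sup>2" for x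
  proof -
    have "(cmod (f x + g x))\<^sup>2 \<le> (cmod (f x) + cmod (g x))\<^sup>2"
      by (rule power_mono[OF norm_triangle_ineq]) simp
    then show ?thesis using sum_squares_bound[of "cmod (f x)" "cmod (g x)"]
      by (simp add: power2_sum)
  qed
  then have "AE x in M. norm ((cmod (f x + g x))\<^sup>2) \<le> norm (2 * (cmod (f x))\<^sup>2 + 2 * (cmod (g x))\<^sup>2)"
    by simp
  moreover have "(\<lambda>x. (cmod (f x + g x))\<^sup>2) \<in> borel_measurable M" using assms by measurable
  ultimately have "integrable M (\<lambda>x. (cmod (f x + g x))\<^sup>2)"
    using int Bochner_Integration.integrable_bound by blast
  then show ?thesis using assms by (auto simp: L2_def)
qed

lemma cnj_measurable [measurable (raw)]: "f \<in> borel_measurable N \<Longrightarrow> (\<lambda>x. cnj (f x)) \<in> borel_measurable N"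
  by (simp add: borel_measurable_complex_iff)

lemma cond_unit_ball_cnj: "v \<in> cond_unit_ball M F \<Longrightarrow> (\<lambda>x. cnj (v x)) \<in> cond_unit_ball M F"
  by (simp add: cond_unit_ball_def cnj_measurable)

lemma cond_unit_ball_measurable [measurable_dest]: "v \<in> cond_unit_ball M F \<Longrightarrow> v \<in> borel_measurable M"
  by (simp add: cond_unit_ball_def)

lemma ess_bounded_cnj: "k \<in> ess_bounded M F \<Longrightarrow> (\<lambda>x. cnj (k x)) \<in> ess_bounded M F"
  by (simp add: ess_bounded_def cnj_measurable)

lemma ess_bounded_measurable: "v \<in> ess_bounded M F \<Longrightarrow> v \<in> borel_measurable F"
  by (simp add: ess_bounded_def)

lemma ess_bounded_mult:
  assumes "k \<in> ess_bounded M F" "l \<in> ess_bounded M F"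
  shows "(\<lambda>x. k x * l x) \<in> ess_bounded M F"
proof -
  obtain K L where "AE x in M. cmod (k x) \<le> K" "AE x in M. cmod (l x) \<le> L"
    using assms by (auto simp: ess_bounded_def)
  then have "AE x in M. cmod (k x * l x) \<le> K * L"
    by eventually_elim (auto simp: norm_mult intro!: mult_mono order_trans[OF norm_ge_zero])
  then show ?thesis using assms by (auto simp: ess_bounded_def)
qed

section \<open>Conditional Cauchy-Schwarz and its consequences on \<open>L2\<close>\<close>

context sigma_finite_subalgebra
begin

lemma nn_integral_nn_cond_exp:
  "g \<in> borel_measurable M \<Longrightarrow> (\<integral>\<^sup>+x. nn_cond_exp M F g x \<partial>M) = (\<integral>\<^sup>+x. g x \<partial>M)"
  using nn_cond_exp_intg[of "\<lambda>_. 1" g] by simp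

lemma L2_sq_cond_integrable:
  assumes f: "f \<in> L2 M"
  shows "f \<in> sq_cond_integrable M F"
proof -
  have [measurable]: "f \<in> borel_measurable M" using f by measurable
  have "(\<integral>\<^sup>+x. nn_cond_exp M F (\<lambda>y. ennreal ((cmod (f y))\<^sup>2)) x \<partial>M) \<noteq> \<infinity>"
    using f by (simp add: nn_integral_nn_cond_exp L2_iff)
  then have "AE x in M. nn_cond_exp M F (\<lambda>y. ennreal ((cmod (f y))\<^sup>2)) x \<noteq> \<infinity>"
    by (rule nn_integral_PInf_AE[rotated]) measurable
  then show ?thesis by (simp add: sq_cond_integrable_def less_top)
qed

lemma cond_unit_ball_sq_cond_integrable: "v \<in> cond_unit_ball M F \<Longrightarrow> v \<in> sq_cond_integrable M F"
  unfolding sq_cond_integrable_def cond_unit_ball_def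
  by (auto elim!: eventually_mono intro: le_less_trans)

lemma nn_cond_exp_am_gm:
  assumes [measurable]: "f \<in> borel_measurable M" "g \<in> borel_measurable M"
  shows "AE x in M. 2 * nn_cond_exp M F (\<lambda>y. ennreal (cmod (f y * g y))) x
    \<le> nn_cond_exp M F (\<lambda>y. ennreal ((cmod (f y))\<^sup>2)) x + nn_cond_exp M F (\<lambda>y. ennreal ((cmod (g y))\<^sup>2)) x"
proof -
  have le: "2 * ennreal (cmod (f x * g x)) \<le> ennreal ((cmod (f x))\<^sup>2) + ennreal ((cmod (g x))\<^sup>2)" for x
  proof -
    have "2 * ennreal (cmod (f x * g x)) = ennreal (2 * cmod (f x) * cmod (g x))"
      by (simp add: ennreal_mult norm_mult mult.assoc)
    also have "\<dots> \<le> ennreal ((cmod (f x))\<^sup>2 + (cmod (g x))\<^sup>2)"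
      by (rule ennreal_leI[OF sum_squares_bound])
    finally show ?thesis by simp
  qed
  have "AE x in M. 2 * nn_cond_exp M F (\<lambda>y. ennreal (cmod (f y * g y))) x
     = nn_cond_exp M F (\<lambda>y. 2 * ennreal (cmod (f y * g y))) x"
    by (rule nn_cond_exp_prod) auto
  moreover have "AE x in M. nn_cond_exp M F (\<lambda>y. 2 * ennreal (cmod (f y * g y))) x
     \<le> nn_cond_exp M F (\<lambda>y. ennreal ((cmod (f y))\<^sup>2) + ennreal ((cmod (g y))\<^sup>2)) x"
    by (rule nn_cond_exp_mono) (use le in auto)
  moreover have "AE x in M. nn_cond_exp M F (\<lambda>y. ennreal ((cmod (f y))\<^sup>2)) x + nn_cond_exp M F (\<lambda>y. ennreal ((cmod (g y))\<^sup>2)) x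
    = nn_cond_exp M F (\<lambda>y. ennreal ((cmod (f y))\<^sup>2) + ennreal ((cmod (g y))\<^sup>2)) x"
    by (rule nn_cond_exp_sum) auto
  ultimately show ?thesis by eventually_elim simp
qed

lemma sq_cond_integrable_mult_dom_E:
  assumes "f \<in> sq_cond_integrable M F" "g \<in> sq_cond_integrable M F"
  shows "(\<lambda>x. f x * g x) \<in> dom_E M F"
proof -
  have [measurable]: "f \<in> borel_measurable M" "g \<in> borel_measurable M"
    and fin: "AE x in M. nn_cond_exp M F (\<lambda>y. ennreal ((cmod (f y))\<^sup>2)) x < \<infinity>"
     "AE x in M. nn_cond_exp M F (\<lambda>y. ennreal ((cmod (g y))\<^sup>2)) x < \<infinity>"
    using assms by (auto simp: sq_cond_integrable_def)
  have "AE x in M. nn_cond_exp M F (\<lambda>y. ennreal (cmod (f y * g y))) x < \<infinity>"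
    using fin nn_cond_exp_am_gm[of f g, simplified]
  proof eventually_elim
    case (elim x)
    let ?p = "nn_cond_exp M F (\<lambda>y. ennreal (cmod (f y * g y))) x"
    have "2 * ?p < \<infinity>"
      using elim by (auto simp: infinity_ennreal_def intro: le_less_trans)
    then show ?case by (auto simp: ennreal_mult_less_top)
  qed
  then show ?thesis by (simp add: dom_E_def)
qed

lemma sq_cond_integrable_F_mult:
  assumes h [measurable]: "h \<in> borel_measurable F" and v: "v \<in> sq_cond_integrable M F"
  shows "(\<lambda>x. h x * v x) \<in> sq_cond_integrable M F"
    and "AE x in M. nn_cond_exp M F (\<lambda>y. ennreal ((cmod (h y * v y))\<^sup>2)) x
      = ennreal ((cmod (h x))\<^sup>2) * nn_cond_exp M F (\<lambda>y. ennreal ((cmod (v y))\<^sup>2)) x"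
proof -
  have [measurable]: "v \<in> borel_measurable M"
    and fin: "AE x in M. nn_cond_exp M F (\<lambda>y. ennreal ((cmod (v y))\<^sup>2)) x < \<infinity>"
    using v by (auto simp: sq_cond_integrable_def)
  have [measurable]: "h \<in> borel_measurable M" by (rule F_imp_M[OF h])
  have "AE x in M. ennreal ((cmod (h x))\<^sup>2) * nn_cond_exp M F (\<lambda>y. ennreal ((cmod (v y))\<^sup>2)) x
    = nn_cond_exp M F (\<lambda>y. ennreal ((cmod (h y))\<^sup>2) * ennreal ((cmod (v y))\<^sup>2)) x"
    by (rule nn_cond_exp_prod) auto
  then show eq: "AE x in M. nn_cond_exp M F (\<lambda>y. ennreal ((cmod (h y * v y))\<^sup>2)) x
      = ennreal ((cmod (h x))\<^sup>2) * nn_cond_exp M F (\<lambda>y. ennreal ((cmod (v y))\<^sup>2)) x"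
    by eventually_elim (simp add: norm_mult power_mult_distrib ennreal_mult)
  have "AE x in M. nn_cond_exp M F (\<lambda>y. ennreal ((cmod (h y * v y))\<^sup>2)) x < \<infinity>"
    using eq fin by eventually_elim (simp add: ennreal_mult_less_top)
  then show "(\<lambda>x. h x * v x) \<in> sq_cond_integrable M F"
    by (simp add: sq_cond_integrable_def)
qed

lemma cond_exp_c_cauchy_schwarz:
  assumes v: "v \<in> cond_unit_ball M F" and g: "g \<in> sq_cond_integrable M F"
  shows "AE x in M. ennreal ((cmod (cond_exp_c M F (\<lambda>y. v y * g y) x))\<^sup>2)
    \<le> nn_cond_exp M F (\<lambda>y. ennreal ((cmod (g y))\<^sup>2)) x"
proof -
  have vS: "v \<in> sq_cond_integrable M F" by (rule cond_unit_ball_sq_cond_integrable[OF v])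
  have [measurable]: "v \<in> borel_measurable M" "g \<in> borel_measurable M"
    and v1: "AE x in M. nn_cond_exp M F (\<lambda>y. ennreal ((cmod (v y))\<^sup>2)) x \<le> 1"
    using v g by (auto simp: sq_cond_integrable_def cond_unit_ball_def)
  \<comment> \<open>AM-GM for \<open>h v\<close> and \<open>g\<close>: \<open>2 |h|\<^sup>2 \<le> |h|\<^sup>2 E(|v|\<^sup>2) + E(|g|\<^sup>2)\<close>.\<close>
  define h where "h x = cnj (cond_exp_c M F (\<lambda>y. v y * g y) x)" for x
  have h [measurable]: "h \<in> borel_measurable F" unfolding h_def by measurable
  have hM [measurable]: "h \<in> borel_measurable M" by (rule F_imp_M[OF h])
  note hv = sq_cond_integrable_F_mult[OF h vS]
  have dom: "(\<lambda>x. h x * v x * g x) \<in> dom_E M F"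
    by (rule sq_cond_integrable_mult_dom_E[OF hv(1) g])
  then have dom': "(\<lambda>x. h x * (v x * g x)) \<in> dom_E M F" by (simp only: mult.assoc)
  have "(\<lambda>y. h y * v y) \<in> borel_measurable M" "g \<in> borel_measurable M" by measurable
  note amgm = nn_cond_exp_am_gm[OF this, unfolded mult.assoc]
  have "AE x in M. cond_exp_c M F (\<lambda>y. h y * (v y * g y)) x = h x * cond_exp_c M F (\<lambda>y. v y * g y) x"
    by (rule cond_exp_c_mult[OF h _ dom']) measurable
  moreover note cond_exp_c_norm_le[OF dom'] v1 hv(2)
    amgm
  ultimately show ?thesis
  proof eventually_elim
    case (elim x)
    let ?e = "cond_exp_c M F (\<lambda>y. v y * g y) x"
    let ?G = "nn_cond_exp M F (\<lambda>y. ennreal ((cmod (g y))\<^sup>2)) x"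
    have "cmod (h x * ?e) = (cmod ?e)\<^sup>2"
      by (simp add: h_def norm_mult power2_eq_square)
    then have "ennreal ((cmod ?e)\<^sup>2) \<le> nn_cond_exp M F (\<lambda>y. ennreal (cmod (h y * (v y * g y)))) x"
      using elim(1,2) by simp
    then have "2 * ennreal ((cmod ?e)\<^sup>2) \<le> 2 * nn_cond_exp M F (\<lambda>y. ennreal (cmod (h y * (v y * g y)))) x"
      by (rule mult_left_mono) simp
    also have "\<dots> \<le> ennreal ((cmod (h x))\<^sup>2) * nn_cond_exp M F (\<lambda>y. ennreal ((cmod (v y))\<^sup>2)) x + ?G"
      using elim(4,5) by simp
    also have "\<dots> \<le> ennreal ((cmod (h x))\<^sup>2) * 1 + ?G"
      by (intro add_mono mult_left_mono elim(3)) auto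
    also have "\<dots> = ennreal ((cmod ?e)\<^sup>2) + ?G"
      by (simp add: h_def)
    finally have "ennreal ((cmod ?e)\<^sup>2) + ennreal ((cmod ?e)\<^sup>2) \<le> ennreal ((cmod ?e)\<^sup>2) + ?G"
      by (simp add: mult_2)
    \<comment> \<open>One copy of |E(v g)|^2 cancels because it is a real number embedded in
      \<open>ennreal\<close>, hence finite.\<close>
    then show ?case by (simp add: ennreal_add_left_cancel_le)
  qed
qed

lemma cond_exp_c_L2:
  assumes v: "v \<in> cond_unit_ball M F" and f: "f \<in> L2 M"
  shows "cond_exp_c M F (\<lambda>y. v y * f y) \<in> L2 M"
    and "(\<integral>\<^sup>+x. ennreal ((cmod (cond_exp_c M F (\<lambda>y. v y * f y) x))\<^sup>2) \<partial>M)
      \<le> (\<integral>\<^sup>+x. ennreal ((cmod (f x))\<^sup>2) \<partial>M)"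
proof -
  have [measurable]: "f \<in> borel_measurable M" using f by measurable
  have "(\<integral>\<^sup>+x. ennreal ((cmod (cond_exp_c M F (\<lambda>y. v y * f y) x))\<^sup>2) \<partial>M)
      \<le> (\<integral>\<^sup>+x. nn_cond_exp M F (\<lambda>y. ennreal ((cmod (f y))\<^sup>2)) x \<partial>M)"
    by (rule nn_integral_mono_AE[OF cond_exp_c_cauchy_schwarz[OF v L2_sq_cond_integrable[OF f]]])
  also have "\<dots> = (\<integral>\<^sup>+x. ennreal ((cmod (f x))\<^sup>2) \<partial>M)"
    by (rule nn_integral_nn_cond_exp) measurable
  finally show le: "(\<integral>\<^sup>+x. ennreal ((cmod (cond_exp_c M F (\<lambda>y. v y * f y) x))\<^sup>2) \<partial>M)
      \<le> (\<integral>\<^sup>+x. ennreal ((cmod (f x))\<^sup>2) \<partial>M)" .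
  show "cond_exp_c M F (\<lambda>y. v y * f y) \<in> L2 M"
    using f le by (auto simp: L2_iff)
qed

text \<open>The weight |h|^2 is \<open>F\<close>-measurable, so under the integral |v|^2 may be
  replaced by E(|v|^2), which is at most 1.\<close>

lemma cond_unit_ball_F_mult_L2:
  assumes v: "v \<in> cond_unit_ball M F" and h: "h \<in> L2 M" and hF [measurable]: "h \<in> borel_measurable F"
  shows "(\<lambda>x. v x * h x) \<in> L2 M"
    and "(\<integral>\<^sup>+x. ennreal ((cmod (v x * h x))\<^sup>2) \<partial>M) \<le> (\<integral>\<^sup>+x. ennreal ((cmod (h x))\<^sup>2) \<partial>M)"
proof -
  have [measurable]: "v \<in> borel_measurable M"
    and v1: "AE x in M. nn_cond_exp M F (\<lambda>y. ennreal ((cmod (v y))\<^sup>2)) x \<le> 1"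
    using v by (auto simp: cond_unit_ball_def)
  have [measurable]: "h \<in> borel_measurable M" using h by measurable
  have "(\<integral>\<^sup>+x. ennreal ((cmod (v x * h x))\<^sup>2) \<partial>M)
      = (\<integral>\<^sup>+x. ennreal ((cmod (h x))\<^sup>2) * ennreal ((cmod (v x))\<^sup>2) \<partial>M)"
    by (simp add: norm_mult power_mult_distrib ennreal_mult mult.commute)
  also have "\<dots> = (\<integral>\<^sup>+x. ennreal ((cmod (h x))\<^sup>2) * nn_cond_exp M F (\<lambda>y. ennreal ((cmod (v y))\<^sup>2)) x \<partial>M)"
    by (rule nn_cond_exp_intg[symmetric]) auto
  also have "\<dots> \<le> (\<integral>\<^sup>+x. ennreal ((cmod (h x))\<^sup>2) * 1 \<partial>M)"
    by (rule nn_integral_mono_AE) (use v1 in eventually_elim, rule mult_left_mono, auto)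
  finally show le: "(\<integral>\<^sup>+x. ennreal ((cmod (v x * h x))\<^sup>2) \<partial>M) \<le> (\<integral>\<^sup>+x. ennreal ((cmod (h x))\<^sup>2) \<partial>M)"
    by simp
  then show "(\<lambda>x. v x * h x) \<in> L2 M"
    using h by (auto simp: L2_iff)
qed

text \<open>The two operations attached to \<open>v\<close>, multiplication by \<open>v\<close> and
  \<open>f\<close> to E(v f), are transposes of each other: \<open>h\<close> passes inside E, and E
  preserves the integral.\<close>

lemma cond_exp_c_duality:
  assumes v: "v \<in> cond_unit_ball M F" and f: "f \<in> L2 M" and h: "h \<in> L2 M" and hF: "h \<in> borel_measurable F"
  shows "(\<integral>x. h x * cond_exp_c M F (\<lambda>y. v y * f y) x \<partial>M) = (\<integral>x. h x * (v x * f x) \<partial>M)"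
proof -
  have [measurable]: "v \<in> borel_measurable M" "f \<in> borel_measurable M" using v f by measurable
  have int: "integrable M (\<lambda>x. h x * (v x * f x))"
    using L2_mult_integrable[OF cond_unit_ball_F_mult_L2(1)[OF v h hF] f] by (simp add: ac_simps)
  have "AE x in M. h x * cond_exp_c M F (\<lambda>y. v y * f y) x = cond_exp_c M F (\<lambda>y. h y * (v y * f y)) x"
    using cond_exp_c_mult_integrable[OF hF _ int] by (simp add: eq_commute)
  then have "(\<integral>x. h x * cond_exp_c M F (\<lambda>y. v y * f y) x \<partial>M) = (\<integral>x. cond_exp_c M F (\<lambda>y. h y * (v y * f y)) x \<partial>M)"
    using F_imp_M[OF hF] by (intro integral_cong_AE) auto
  also have "\<dots> = (\<integral>x. h x * (v x * f x) \<partial>M)" by (rule cond_exp_c_integral(2)[OF int])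
  finally show ?thesis .
qed

lemma ess_bounded_mult_L2:
  assumes k: "k \<in> ess_bounded M F" and h: "h \<in> L2 M"
  shows "(\<lambda>x. k x * h x) \<in> L2 M"
proof -
  obtain K where K: "AE x in M. cmod (k x) \<le> K" using k by (auto simp: ess_bounded_def)
  have [measurable]: "k \<in> borel_measurable M" "h \<in> borel_measurable M"
    using F_imp_M[OF ess_bounded_measurable[OF k]] h by auto
  show ?thesis
    by (rule L2_dominated[OF h, of _ K])
      (measurable, use K in eventually_elim, simp add: norm_mult mult_right_mono)
qed

section \<open>Boundedness, adjoints and products of the operators \<open>wop\<close>\<close>

lemma wop_L2:
  assumes "k \<in> ess_bounded M F" "z \<in> cond_unit_ball M F" "v \<in> cond_unit_ball M F" "f \<in> L2 M"
  shows "wop M F k z v f \<in> L2 M"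
  unfolding wop_def
  by (intro ess_bounded_mult_L2 cond_unit_ball_F_mult_L2(1) cond_exp_c_L2(1) assms cond_exp_c_measurable)

lemma wop_bound:
  assumes k: "k \<in> ess_bounded M F" and z: "z \<in> cond_unit_ball M F" and v: "v \<in> cond_unit_ball M F"
  shows "\<exists>C. \<forall>f\<in>L2 M. l2_norm M (wop M F k z v f) \<le> C * l2_norm M f"
proof -
  obtain K where K: "AE x in M. cmod (k x) \<le> K" using k by (auto simp: ess_bounded_def)
  have [measurable]: "k \<in> borel_measurable M" "z \<in> borel_measurable M"
    using F_imp_M[OF ess_bounded_measurable[OF k]] z by auto
  have "l2_norm M (wop M F k z v f) \<le> \<bar>K\<bar> * l2_norm M f" if f: "f \<in> L2 M" for f
  proof (rule l2_norm_leI[OF wop_L2[OF k z v f] f])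
    let ?e = "cond_exp_c M F (\<lambda>y. v y * f y)"
    have "(\<integral>\<^sup>+x. ennreal ((cmod (wop M F k z v f x))\<^sup>2) \<partial>M)
        \<le> (\<integral>\<^sup>+x. ennreal (\<bar>K\<bar>\<^sup>2) * ennreal ((cmod (z x * ?e x))\<^sup>2) \<partial>M)"
    proof (rule nn_integral_mono_AE, use K in eventually_elim)
      fix x assume "cmod (k x) \<le> K"
      then have "cmod (k x) \<le> \<bar>K\<bar>" by simp
      then have "(cmod (k x))\<^sup>2 * (cmod (z x * ?e x))\<^sup>2 \<le> \<bar>K\<bar>\<^sup>2 * (cmod (z x * ?e x))\<^sup>2"
        by (intro mult_right_mono power_mono) auto
      then show "ennreal ((cmod (wop M F k z v f x))\<^sup>2) \<le> ennreal (\<bar>K\<bar>\<^sup>2) * ennreal ((cmod (z x * ?e x))\<^sup>2)"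
        unfolding wop_def norm_mult[of "k _"] power_mult_distrib
        by (simp add: ennreal_mult[symmetric] ennreal_leI)
    qed
    also have "\<dots> = ennreal (\<bar>K\<bar>\<^sup>2) * (\<integral>\<^sup>+x. ennreal ((cmod (z x * ?e x))\<^sup>2) \<partial>M)"
      by (rule nn_integral_cmult) measurable
    also have "\<dots> \<le> ennreal (\<bar>K\<bar>\<^sup>2) * (\<integral>\<^sup>+x. ennreal ((cmod (f x))\<^sup>2) \<partial>M)"
      by (intro mult_left_mono order_trans[OF cond_unit_ball_F_mult_L2(2) cond_exp_c_L2(2)]
          z v f cond_exp_c_measurable cond_exp_c_L2(1)) simp
    finally show "(\<integral>\<^sup>+x. ennreal ((cmod (wop M F k z v f x))\<^sup>2) \<partial>M)
        \<le> ennreal (\<bar>K\<bar>\<^sup>2) * (\<integral>\<^sup>+x. ennreal ((cmod (f x))\<^sup>2) \<partial>M)" .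
  qed simp
  then show ?thesis by blast
qed

lemma cond_unit_ball_mult_L2_dom_E:
  "v \<in> cond_unit_ball M F \<Longrightarrow> f \<in> L2 M \<Longrightarrow> (\<lambda>x. v x * f x) \<in> dom_E M F"
  by (intro sq_cond_integrable_mult_dom_E cond_unit_ball_sq_cond_integrable L2_sq_cond_integrable)

lemma wop_linear:
  assumes v: "v \<in> cond_unit_ball M F" and f: "f \<in> L2 M" and g: "g \<in> L2 M"
  shows "AE x in M. wop M F k z v (\<lambda>x. a * f x + b * g x) x = a * wop M F k z v f x + b * wop M F k z v g x"
proof -
  have [measurable]: "v \<in> borel_measurable M" "f \<in> borel_measurable M" "g \<in> borel_measurable M"
    using v f g by auto
  have af: "(\<lambda>x. a * (v x * f x)) \<in> dom_E M F"
    using cond_unit_ball_mult_L2_dom_E[OF v L2_scale[OF f, of a]] by (simp add: ac_simps)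
  have bg: "(\<lambda>x. b * (v x * g x)) \<in> dom_E M F"
    using cond_unit_ball_mult_L2_dom_E[OF v L2_scale[OF g, of b]] by (simp add: ac_simps)
  have eq: "(\<lambda>y. v y * (a * f y + b * g y)) = (\<lambda>y. a * (v y * f y) + b * (v y * g y))"
    by (simp add: algebra_simps)
  have "AE x in M. cond_exp_c M F (\<lambda>x. a * (v x * f x)) x = a * cond_exp_c M F (\<lambda>x. v x * f x) x"
    by (rule cond_exp_c_mult[OF _ _ af]) auto
  moreover have "AE x in M. cond_exp_c M F (\<lambda>x. b * (v x * g x)) x = b * cond_exp_c M F (\<lambda>x. v x * g x) x"
    by (rule cond_exp_c_mult[OF _ _ bg]) auto
  moreover note cond_exp_c_add[OF af bg]
  ultimately show ?thesis
    unfolding wop_def eq by eventually_elim (simp add: algebra_simps)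
qed

lemma wop_bounded_op:
  assumes "k \<in> ess_bounded M F" "z \<in> cond_unit_ball M F" "v \<in> cond_unit_ball M F"
  shows "bounded_op M (wop M F k z v)"
  unfolding bounded_op_def ae_eq_def using assms wop_L2 wop_linear wop_bound by blast

lemma wop_cong:
  assumes "AE x in M. f x = g x" "f \<in> L2 M" "g \<in> L2 M" "v \<in> borel_measurable M"
  shows "AE x in M. wop M F k z v f x = wop M F k z v g x"
proof -
  have "AE x in M. cond_exp_c M F (\<lambda>y. v y * f y) x = cond_exp_c M F (\<lambda>y. v y * g y) x"
    by (rule cond_exp_c_cong) (use assms in auto)
  then show ?thesis unfolding wop_def by eventually_elim simp
qed

text \<open>Duality is applied once for \<open>z\<close>, turning z cnj g into E(z cnj g), and once
  for \<open>v\<close> in the opposite direction. The two symbols therefore exchange places and are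
  conjugated.\<close>

lemma wop_adjoint:
  assumes k: "k \<in> ess_bounded M F" and z: "z \<in> cond_unit_ball M F" and v: "v \<in> cond_unit_ball M F"
  shows "is_adjoint M (wop M F k z v) (wop M F (\<lambda>x. cnj (k x)) (\<lambda>x. cnj (v x)) (\<lambda>x. cnj (z x)))"
  unfolding is_adjoint_def
proof safe
  note k' = ess_bounded_cnj[OF k] and z' = cond_unit_ball_cnj[OF z] and v' = cond_unit_ball_cnj[OF v]
  note kF [measurable] = ess_bounded_measurable[OF k]
  fix g assume g: "g \<in> L2 M"
  show "wop M F (\<lambda>x. cnj (k x)) (\<lambda>x. cnj (v x)) (\<lambda>x. cnj (z x)) g \<in> L2 M"
    by (rule wop_L2[OF k' v' z' g])
  fix f assume f: "f \<in> L2 M"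
  let ?e = "cond_exp_c M F (\<lambda>y. v y * f y)" and ?d = "cond_exp_c M F (\<lambda>y. z y * cnj (g y))"
  have d: "cnj (cond_exp_c M F (\<lambda>y. cnj (z y) * g y) x) = ?d x" for x
    using cond_exp_c_cnj[of "\<lambda>y. z y * cnj (g y)" x] by simp
  have "l2_inner M (wop M F k z v f) g = (\<integral>x. (k x * ?e x) * (z x * cnj (g x)) \<partial>M)"
    by (simp add: l2_inner_def wop_def ac_simps)
  also have "\<dots> = (\<integral>x. (k x * ?e x) * ?d x \<partial>M)"
    by (rule cond_exp_c_duality[OF z L2_cnj[OF g], symmetric])
      (auto intro!: ess_bounded_mult_L2 k cond_exp_c_L2 v f)
  also have "\<dots> = (\<integral>x. (k x * ?d x) * ?e x \<partial>M)" by (simp add: ac_simps)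
  also have "\<dots> = (\<integral>x. (k x * ?d x) * (v x * f x) \<partial>M)"
    by (rule cond_exp_c_duality[OF v f])
      (auto intro!: ess_bounded_mult_L2 k cond_exp_c_L2 z L2_cnj g)
  also have "\<dots> = l2_inner M f (wop M F (\<lambda>x. cnj (k x)) (\<lambda>x. cnj (v x)) (\<lambda>x. cnj (z x)) g)"
    unfolding l2_inner_def wop_def complex_cnj_mult complex_cnj_cnj d by (simp add: ac_simps)
  finally show "l2_inner M (wop M F k z v f) g
      = l2_inner M f (wop M F (\<lambda>x. cnj (k x)) (\<lambda>x. cnj (v x)) (\<lambda>x. cnj (z x)) g)" .
qed

text \<open>The conditional inner product of two elements of the unit ball. The bound is
  Cauchy-Schwarz, and it keeps the coefficients of products inside
  \<open>ess_bounded\<close>.\<close>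

lemma cond_exp_c_ess_bounded:
  assumes v: "v \<in> cond_unit_ball M F" and y: "y \<in> cond_unit_ball M F"
  shows "AE x in M. cmod (cond_exp_c M F (\<lambda>t. v t * y t) x) \<le> 1"
    and "cond_exp_c M F (\<lambda>t. v t * y t) \<in> ess_bounded M F"
proof -
  have "AE x in M. nn_cond_exp M F (\<lambda>t. ennreal ((cmod (y t))\<^sup>2)) x \<le> 1"
    using y by (simp add: cond_unit_ball_def)
  with cond_exp_c_cauchy_schwarz[OF v cond_unit_ball_sq_cond_integrable[OF y]]
  show *: "AE x in M. cmod (cond_exp_c M F (\<lambda>t. v t * y t) x) \<le> 1"
  proof eventually_elim
    case (elim x)
    then have "ennreal ((cmod (cond_exp_c M F (\<lambda>t. v t * y t) x))\<^sup>2) \<le> ennreal 1"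
      using order_trans by fastforce
    then have "(cmod (cond_exp_c M F (\<lambda>t. v t * y t) x))\<^sup>2 \<le> 1"
      by (subst (asm) ennreal_le_iff) auto
    then show ?case by (simp add: abs_square_le_1)
  qed
  then show "cond_exp_c M F (\<lambda>t. v t * y t) \<in> ess_bounded M F"
    by (auto simp: ess_bounded_def)
qed

text \<open>As for rank-one operators, the inner symbols contract to the scalar E(v y), once the
  \<open>F\<close>-measurable factors \<open>l\<close> and E(u f) are pulled out of the outer
  expectation.\<close>

lemma wop_comp:
  assumes l: "l \<in> ess_bounded M F" and v: "v \<in> cond_unit_ball M F"
    and y: "y \<in> cond_unit_ball M F" and u: "u \<in> cond_unit_ball M F" and f: "f \<in> L2 M"
  shows "AE x in M. wop M F k z v (wop M F l y u f) x
     = wop M F (\<lambda>x. k x * l x * cond_exp_c M F (\<lambda>t. v t * y t) x) z u f x"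
proof -
  note [measurable] = ess_bounded_measurable[OF l]
  let ?e = "cond_exp_c M F (\<lambda>t. u t * f t)"
  have [measurable]: "v \<in> borel_measurable M" "y \<in> borel_measurable M" using v y by auto
  have "(\<lambda>t. v t * (l t * (y t * ?e t))) \<in> dom_E M F"
    using cond_unit_ball_mult_L2_dom_E[OF v wop_L2[OF l y u f]] by (simp add: wop_def)
  then have dom: "(\<lambda>t. (l t * ?e t) * (v t * y t)) \<in> dom_E M F" by (simp add: ac_simps)
  have eq: "(\<lambda>t. v t * wop M F l y u f t) = (\<lambda>t. (l t * ?e t) * (v t * y t))"
    by (simp add: wop_def ac_simps)
  have "AE x in M. cond_exp_c M F (\<lambda>t. (l t * ?e t) * (v t * y t)) x
      = (l x * ?e x) * cond_exp_c M F (\<lambda>t. v t * y t) x"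
    by (rule cond_exp_c_mult[OF _ _ dom]) measurable
  then show ?thesis
    unfolding wop_def[of M F k] wop_def[of M F _ z u] eq by eventually_elim (simp add: ac_simps)
qed

end

section \<open>Adjoints and square roots\<close>

lemma l2_inner_cnj: "cnj (l2_inner M f g) = l2_inner M g f"
  unfolding l2_inner_def Bochner_Integration.integral_cnj[symmetric] by (simp add: mult.commute)

lemma l2_inner_self: "f \<in> L2 M \<Longrightarrow> l2_inner M f f = of_real ((l2_norm M f)\<^sup>2)"
  by (simp add: l2_inner_def l2_norm_def L2_def complex_norm_square[symmetric] flip: of_real_power)

lemma L2_inner_integrable: "f \<in> L2 M \<Longrightarrow> g \<in> L2 M \<Longrightarrow> integrable M (\<lambda>x. f x * cnj (g x))"
  by (intro L2_mult_integrable L2_cnj)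

lemma l2_inner_add_left:
  assumes "f \<in> L2 M" "g \<in> L2 M" "h \<in> L2 M"
  shows "l2_inner M (\<lambda>x. a * f x + b * g x) h = a * l2_inner M f h + b * l2_inner M g h"
proof -
  have "integrable M (\<lambda>x. a * (f x * cnj (h x)))" "integrable M (\<lambda>x. b * (g x * cnj (h x)))"
    using assms by (simp_all add: L2_inner_integrable)
  from Bochner_Integration.integral_add[OF this] show ?thesis
    by (simp add: l2_inner_def algebra_simps)
qed

lemma l2_inner_add_right:
  "f \<in> L2 M \<Longrightarrow> g \<in> L2 M \<Longrightarrow> h \<in> L2 M \<Longrightarrow>
    l2_inner M h (\<lambda>x. a * f x + b * g x) = cnj a * l2_inner M h f + cnj b * l2_inner M h g"
  using l2_inner_add_left[of f M g h a b]
  by (metis complex_cnj_add complex_cnj_mult l2_inner_cnj)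

lemma l2_inner_cong:
  assumes "AE x in M. f x = f' x" "AE x in M. g x = g' x"
    and [measurable]: "f \<in> borel_measurable M" "f' \<in> borel_measurable M"
      "g \<in> borel_measurable M" "g' \<in> borel_measurable M"
  shows "l2_inner M f g = l2_inner M f' g'"
  unfolding l2_inner_def
  by (rule integral_cong_AE) (measurable, use assms(1,2) in eventually_elim, simp)

lemma l2_cauchy_schwarz:
  assumes f: "f \<in> L2 M" and g: "g \<in> L2 M"
  shows "cmod (l2_inner M f g) \<le> l2_norm M f * l2_norm M g"
proof -
  have [measurable]: "f \<in> borel_measurable M" "g \<in> borel_measurable M" using f g by auto
  have int: "integrable M (\<lambda>x. cmod (f x) * cmod (g x))"
    using integrable_norm[OF L2_mult_integrable[OF f g]] by (simp add: norm_mult)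
  have "(ennreal (\<integral>x. cmod (f x) * cmod (g x) \<partial>M))\<^sup>2
      = (\<integral>\<^sup>+x. ennreal (cmod (f x)) * ennreal (cmod (g x)) \<partial>M)\<^sup>2"
    using nn_integral_eq_integral[OF int] by (simp add: ennreal_mult)
  also have "\<dots> \<le> (\<integral>\<^sup>+x. (ennreal (cmod (f x)))\<^sup>2 \<partial>M) * (\<integral>\<^sup>+x. (ennreal (cmod (g x)))\<^sup>2 \<partial>M)"
    by (rule Cauchy_Schwarz_nn_integral) measurable
  also have "\<dots> = ennreal ((l2_norm M f * l2_norm M g)\<^sup>2)"
    using L2_nn_norm[OF f] L2_nn_norm[OF g]
    by (simp add: ennreal_power ennreal_mult power_mult_distrib)
  finally have "(\<integral>x. cmod (f x) * cmod (g x) \<partial>M)\<^sup>2 \<le> (l2_norm M f * l2_norm M g)\<^sup>2"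
    by (simp add: ennreal_power)
  then have "(\<integral>x. cmod (f x) * cmod (g x) \<partial>M) \<le> l2_norm M f * l2_norm M g"
    by (rule power2_le_imp_le) (simp add: l2_norm_nonneg)
  moreover have "cmod (l2_inner M f g) \<le> (\<integral>x. cmod (f x) * cmod (g x) \<partial>M)"
    unfolding l2_inner_def by (rule order_trans[OF integral_norm_bound]) (simp add: norm_mult)
  ultimately show ?thesis by linarith
qed

lemma l2_norm_zero_AE:
  assumes f: "f \<in> L2 M" and z: "l2_norm M f = 0"
  shows "AE x in M. f x = 0"
  using integral_nonneg_eq_0_iff_AE[OF L2_sq_integrable[OF f]] z
  by (simp add: l2_norm_def)

section \<open>Adjoints up to equality almost everywhere\<close>

lemma is_adjoint_L2: "is_adjoint M T S \<Longrightarrow> g \<in> L2 M \<Longrightarrow> S g \<in> L2 M"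
  by (simp add: is_adjoint_def)

lemma is_adjoint_inner:
  "is_adjoint M T S \<Longrightarrow> f \<in> L2 M \<Longrightarrow> g \<in> L2 M \<Longrightarrow> l2_inner M (T f) g = l2_inner M f (S g)"
  by (simp add: is_adjoint_def)

lemma adj_is_adjoint: "is_adjoint M T S \<Longrightarrow> is_adjoint M T (adj M T)"
  unfolding adj_def using someI[of "is_adjoint M T" S] by simp

text \<open>The difference \<open>d\<close> of the two values satisfies <d, d> = <T d, g> - <T d,
  g'> = 0. As \<open>adj\<close> is an arbitrary choice acting on representatives, two adjoints and
  two representatives are compared at once.\<close>

lemma is_adjoint_unique:
  assumes S: "is_adjoint M T S" and S': "is_adjoint M T S'" and g: "g \<in> L2 M" and g': "g' \<in> L2 M"
    and eq: "AE x in M. g x = g' x"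
    and T: "\<And>f. f \<in> L2 M \<Longrightarrow> T f \<in> L2 M"
  shows "AE x in M. S g x = S' g' x"
proof -
  have L: "S g \<in> L2 M" "S' g' \<in> L2 M" using S S' g g' by (auto simp: is_adjoint_L2)
  let ?d = "\<lambda>x. 1 * S g x + (-1) * S' g' x"
  have d: "?d \<in> L2 M" by (intro L2_add L2_scale L)
  have "l2_inner M ?d ?d = l2_inner M ?d (S g) - l2_inner M ?d (S' g')"
    using l2_inner_add_right[OF L d, of 1 "-1"] by simp
  also have "\<dots> = l2_inner M (T ?d) g - l2_inner M (T ?d) g'"
    using is_adjoint_inner[OF S d g] is_adjoint_inner[OF S' d g'] by simp
  also have "l2_inner M (T ?d) g = l2_inner M (T ?d) g'"
    by (rule l2_inner_cong) (use eq T[OF d] g g' in auto)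
  finally have "l2_norm M ?d = 0" using l2_inner_self[OF d] by simp
  from l2_norm_zero_AE[OF d this] show ?thesis by simp
qed

lemma is_adjoint_sym:
  assumes "is_adjoint M T S" "\<And>f. f \<in> L2 M \<Longrightarrow> T f \<in> L2 M"
  shows "is_adjoint M S T"
  using assms unfolding is_adjoint_def by (metis l2_inner_cnj)

lemma is_adjoint_cong:
  assumes "is_adjoint M T S" "\<And>f. f \<in> L2 M \<Longrightarrow> AE x in M. T' f x = T f x"
    "\<And>f. f \<in> L2 M \<Longrightarrow> T f \<in> L2 M" "\<And>f. f \<in> L2 M \<Longrightarrow> T' f \<in> L2 M"
  shows "is_adjoint M T' S"
  unfolding is_adjoint_def
proof safe
  fix g assume g: "g \<in> L2 M"
  then show "S g \<in> L2 M" using assms(1) by (rule is_adjoint_L2[rotated])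
  fix f assume f: "f \<in> L2 M"
  have "l2_inner M (T' f) g = l2_inner M (T f) g"
    by (rule l2_inner_cong) (use f g assms in auto)
  then show "l2_inner M (T' f) g = l2_inner M f (S g)"
    by (simp add: is_adjoint_inner[OF assms(1) f g])
qed

section \<open>Positive operators and their use as square roots\<close>

lemma bounded_op_L2: "bounded_op M T \<Longrightarrow> f \<in> L2 M \<Longrightarrow> T f \<in> L2 M"
  by (simp add: bounded_op_def)

lemma bounded_op_linear:
  "bounded_op M T \<Longrightarrow> f \<in> L2 M \<Longrightarrow> g \<in> L2 M \<Longrightarrow>
    AE x in M. T (\<lambda>x. a * f x + b * g x) x = a * T f x + b * T g x"
  by (simp add: bounded_op_def ae_eq_def)

text \<open>\<open>op_le\<close> demands a real quadratic form, and by polarization an operator with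
  real quadratic form is self-adjoint.\<close>

lemma positive_op_selfadjoint:
  assumes R: "bounded_op M R" and pos: "positive_op M R"
  shows "is_adjoint M R R"
  unfolding is_adjoint_def
proof safe
  note RL = bounded_op_L2[OF R]
  fix g assume g: "g \<in> L2 M"
  then show "R g \<in> L2 M" by (rule RL)
  fix f assume f: "f \<in> L2 M"
  have real: "Im (l2_inner M (R h) h) = 0" if "h \<in> L2 M" for h
    using pos that by (auto simp: positive_op_def op_le_def l2_inner_def)
  have exp: "l2_inner M (R (\<lambda>x. 1 * f x + b * g x)) (\<lambda>x. 1 * f x + b * g x)
      = l2_inner M (R f) f + cnj b * l2_inner M (R f) g + b * l2_inner M (R g) f
        + b * cnj b * l2_inner M (R g) g" for b
  proof -
    have L: "(\<lambda>x. 1 * f x + b * g x) \<in> L2 M" "(\<lambda>x. 1 * R f x + b * R g x) \<in> L2 M"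
      by (intro L2_add L2_scale f g RL)+
    have "l2_inner M (R (\<lambda>x. 1 * f x + b * g x)) (\<lambda>x. 1 * f x + b * g x)
      = l2_inner M (\<lambda>x. 1 * R f x + b * R g x) (\<lambda>x. 1 * f x + b * g x)"
      by (rule l2_inner_cong[OF bounded_op_linear[OF R f g]]) (use L RL in auto)
    also have "\<dots> = l2_inner M (R f) f + cnj b * l2_inner M (R f) g + b * l2_inner M (R g) f
        + b * cnj b * l2_inner M (R g) g"
      unfolding l2_inner_add_left[OF RL[OF f] RL[OF g] L(1)]
        l2_inner_add_right[OF f g RL[OF f]] l2_inner_add_right[OF f g RL[OF g]]
      by (simp add: algebra_simps)
    finally show ?thesis .
  qed
  have "Im (l2_inner M (R (\<lambda>x. 1 * f x + b * g x)) (\<lambda>x. 1 * f x + b * g x)) = 0" for b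
    by (intro real L2_add L2_scale f g)
  \<comment> \<open>\<open>b = 1\<close> shows Im <R f, g> = - Im <R g, f>, and \<open>b\<close> the
    imaginary unit shows that the real parts agree.\<close>
  from this[of 1, unfolded exp] this[of \<i>, unfolded exp]
  have "l2_inner M (R f) g = cnj (l2_inner M (R g) f)"
    using real[OF f] real[OF g] by (simp add: complex_eq_iff)
  then show "l2_inner M (R f) g = l2_inner M f (R g)" by (simp add: l2_inner_cnj)
qed

text \<open>||R f||^2 = <f, R (R f)> = <f, S (T f)> = ||T f||^2. All positive square roots thus have
  the same norms, so it does not matter which one \<open>op_abs\<close> picks.\<close>

lemma sqrt_op_norm:
  assumes R: "bounded_op M R" and pos: "positive_op M R"
    and sq: "AE x in M. R (R f) x = S (T f) x"
    and adj: "is_adjoint M T S" and T: "T f \<in> L2 M" and f: "f \<in> L2 M"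
  shows "l2_norm M (R f) = l2_norm M (T f)"
proof -
  note RL = bounded_op_L2[OF R]
  have "l2_inner M (R f) (R f) = l2_inner M f (R (R f))"
    using is_adjoint_inner[OF positive_op_selfadjoint[OF R pos] f RL[OF f]] by simp
  also have "\<dots> = l2_inner M f (S (T f))"
    by (rule l2_inner_cong[OF _ sq]) (use f RL is_adjoint_L2[OF adj T] in auto)
  also have "\<dots> = l2_inner M (T f) (T f)" by (rule is_adjoint_inner[OF adj f T, symmetric])
  finally have "(l2_norm M (R f))\<^sup>2 = (l2_norm M (T f))\<^sup>2"
    unfolding l2_inner_self[OF RL[OF f]] l2_inner_self[OF T] of_real_eq_iff .
  then show ?thesis by (simp add: power2_eq_iff_nonneg l2_norm_nonneg)
qed

text \<open>The witness \<open>R\<close> makes the choice in \<open>op_abs\<close> meaningful; uniqueness of the square root is never needed.\<close>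

lemma op_abs_properties:
  assumes "bounded_op M R" "positive_op M R" "\<forall>f\<in>L2 M. AE x in M. R (R f) x = adj M T (T f) x"
  shows "bounded_op M (op_abs M T)" "positive_op M (op_abs M T)"
    "\<And>f. f \<in> L2 M \<Longrightarrow> AE x in M. op_abs M T (op_abs M T f) x = adj M T (T f) x"
proof -
  have "bounded_op M (op_abs M T) \<and> positive_op M (op_abs M T) \<and>
     (\<forall>f\<in>L2 M. ae_eq M (op_abs M T (op_abs M T f)) (adj M T (T f)))"
    unfolding op_abs_def by (rule someI[of _ R]) (use assms in \<open>auto simp: ae_eq_def\<close>)
  then show "bounded_op M (op_abs M T)" "positive_op M (op_abs M T)"
    "\<And>f. f \<in> L2 M \<Longrightarrow> AE x in M. op_abs M T (op_abs M T f) x = adj M T (T f) x"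
    by (auto simp: ae_eq_def)
qed

text \<open>Put g = T f and move the outer adjoint of the quasi-star-A inequality onto
  \<open>f\<close>. The smaller side becomes <T (S g), g> = ||S g||^2. The larger becomes <|T^2| g,
  g>, which is at most the norm of |T^2| g times ||g||, that is ||T (T g)|| ||g||. \<open>R1\<close>
  and \<open>R2\<close> certify that the two square roots exist.\<close>

lemma quasi_star_A_norm_le:
  assumes T: "bounded_op M T" and S: "is_adjoint M T S"
    and R1: "bounded_op M R1" "positive_op M R1" "\<And>f. f \<in> L2 M \<Longrightarrow> AE x in M. R1 (R1 f) x = T (S f) x"
    and R2: "bounded_op M R2" "positive_op M R2" "\<And>f. f \<in> L2 M \<Longrightarrow> AE x in M. R2 (R2 f) x = S (S (T (T f))) x"
    and quasi: "quasi_star_A M T" and f: "f \<in> L2 M"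
  shows "(l2_norm M (S (T f)))\<^sup>2 \<le> l2_norm M (T (T (T f))) * l2_norm M (T f)"
proof -
  note TL = bounded_op_L2[OF T] and SL = is_adjoint_L2[OF S]
  define A where "A = adj M T"
  have A: "is_adjoint M T A" unfolding A_def by (rule adj_is_adjoint[OF S])
  note AL = is_adjoint_L2[OF A]
  have ST: "is_adjoint M S T" by (rule is_adjoint_sym[OF S TL])
  have AT: "is_adjoint M A T" by (rule is_adjoint_sym[OF A TL])
  have A': "is_adjoint M A (adj M A)" by (rule adj_is_adjoint[OF AT])
  \<comment> \<open>\<open>adj M A\<close> is again an arbitrary choice. Two uses of uniqueness
    identify first \<open>A h\<close> with \<open>S h\<close>, then the adjoint of the adjoint with
    \<open>T\<close>.\<close>
  have TS: "AE x in M. adj M A (A h) x = T (S h) x" if h: "h \<in> L2 M" for h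
  proof -
    have "AE x in M. A h x = S h x" by (rule is_adjoint_unique[OF A S h h _ TL]) simp
    then show ?thesis by (rule is_adjoint_unique[OF A' AT AL[OF h] SL[OF h] _ AL])
  qed
  define Q where "Q = op_abs M A"
  have "\<forall>h\<in>L2 M. AE x in M. R1 (R1 h) x = adj M A (A h) x"
  proof
    fix h assume "h \<in> L2 M"
    from R1(3)[OF this] TS[OF this] show "AE x in M. R1 (R1 h) x = adj M A (A h) x"
      by eventually_elim simp
  qed
  note Q = op_abs_properties[OF R1(1,2) this, folded Q_def]
  define T2 where "T2 g = T (T g)" for g
  have T2L: "T2 g \<in> L2 M" if "g \<in> L2 M" for g unfolding T2_def by (intro TL that)
  have SS: "is_adjoint M T2 (\<lambda>g. S (S g))"
    unfolding is_adjoint_def T2_def by (simp add: SL is_adjoint_inner[OF S] TL)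
  have adjT2: "is_adjoint M T2 (adj M T2)" by (rule adj_is_adjoint[OF SS])
  have "\<forall>h\<in>L2 M. AE x in M. R2 (R2 h) x = adj M T2 (T2 h) x"
  proof
    fix h assume h: "h \<in> L2 M"
    have "AE x in M. adj M T2 (T2 h) x = S (S (T2 h)) x"
      by (rule is_adjoint_unique[OF adjT2 SS T2L[OF h] T2L[OF h] _ T2L]) simp
    with R2(3)[OF h] show "AE x in M. R2 (R2 h) x = adj M T2 (T2 h) x" by eventually_elim (simp add: T2_def)
  qed
  note P = op_abs_properties[OF R2(1,2) this]
  define P where "P = op_abs M T2"
  note P = P[folded P_def]
  define g where "g = T f"
  have g: "g \<in> L2 M" unfolding g_def by (rule TL[OF f])
  have inner_A: "l2_inner M (A h) f = l2_inner M h g" if h: "h \<in> L2 M" for h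
    unfolding g_def by (rule is_adjoint_inner[OF AT h f])
  have QQ: "Q (Q g) \<in> L2 M" by (intro bounded_op_L2[OF Q(1)] g)
  have Pg: "P g \<in> L2 M" by (intro bounded_op_L2[OF P(1)] g)
  have "0 \<le> Re (l2_inner M (A (P g)) f - l2_inner M (A (Q (Q g))) f)"
    using quasi f unfolding quasi_star_A_def op_le_def A_def[symmetric] Q_def[symmetric]
      P_def[symmetric] g_def T2_def[symmetric, abs_def] by blast
  then have "Re (l2_inner M (Q (Q g)) g) \<le> Re (l2_inner M (P g) g)"
    by (simp add: inner_A[OF QQ] inner_A[OF Pg])
  moreover have "l2_inner M (Q (Q g)) g = of_real ((l2_norm M (S g))\<^sup>2)"
  proof -
    have "l2_inner M (Q (Q g)) g = l2_inner M (T (S g)) g"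
      by (rule l2_inner_cong) (use Q(3)[OF g] TS[OF g] QQ g TL SL in auto)
    also have "\<dots> = l2_inner M (S g) (S g)" by (rule is_adjoint_inner[OF S SL[OF g] g])
    finally show ?thesis by (simp add: l2_inner_self[OF SL[OF g]])
  qed
  moreover have "Re (l2_inner M (P g) g) \<le> l2_norm M (P g) * l2_norm M g"
    using complex_Re_le_cmod l2_cauchy_schwarz[OF Pg g] by (rule order_trans)
  moreover have "l2_norm M (P g) = l2_norm M (T2 g)"
    by (rule sqrt_op_norm[OF P(1,2) P(3)[OF g] adjT2 T2L[OF g] g])
  ultimately show ?thesis unfolding g_def T2_def by simp
qed

section \<open>The normal form under the quasi-*-A condition\<close>

text \<open>Equality in place of an inequality: such a \<open>v\<close> vanishes almost everywhere
  off \<open>Z\<close>, and multiplication by it is isometric on the \<open>F\<close>-measurable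
  \<open>L2\<close> functions supported in \<open>Z\<close>.\<close>

definition cond_unit_on :: "'a measure \<Rightarrow> 'a measure \<Rightarrow> 'a set \<Rightarrow> ('a \<Rightarrow> complex) set" where
  "cond_unit_on M F Z = {v \<in> borel_measurable M.
     AE x in M. nn_cond_exp M F (\<lambda>y. ennreal ((cmod (v y))\<^sup>2)) x = indicator Z x}"

lemma cond_unit_on_subset: "v \<in> cond_unit_on M F Z \<Longrightarrow> v \<in> cond_unit_ball M F"
  by (auto simp: cond_unit_on_def cond_unit_ball_def indicator_def elim!: eventually_mono)

lemma cond_unit_on_cnj: "v \<in> cond_unit_on M F Z \<Longrightarrow> (\<lambda>x. cnj (v x)) \<in> cond_unit_on M F Z"
  by (simp add: cond_unit_on_def cnj_measurable)

lemma l2_norm_cong: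
  assumes "AE x in M. f x = g x" and [measurable]: "f \<in> borel_measurable M" "g \<in> borel_measurable M"
  shows "l2_norm M f = l2_norm M g"
  unfolding l2_norm_def
  by (rule arg_cong[where f = sqrt], rule integral_cong_AE)
    (measurable, use assms(1) in eventually_elim, simp)

lemma l2_norm_mono:
  assumes f: "f \<in> L2 M" and g: "g \<in> L2 M" and C: "0 \<le> C"
    and le: "AE x in M. cmod (f x) \<le> C * cmod (g x)"
  shows "l2_norm M f \<le> C * l2_norm M g"
proof (rule l2_norm_leI[OF f g C])
  have [measurable]: "g \<in> borel_measurable M" using g by measurable
  have "(\<integral>\<^sup>+x. ennreal ((cmod (f x))\<^sup>2) \<partial>M) \<le> (\<integral>\<^sup>+x. ennreal (C\<^sup>2) * ennreal ((cmod (g x))\<^sup>2) \<partial>M)"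
  proof (rule nn_integral_mono_AE, use le in eventually_elim)
    fix x assume "cmod (f x) \<le> C * cmod (g x)"
    from power_mono[OF this norm_ge_zero, of 2]
    show "ennreal ((cmod (f x))\<^sup>2) \<le> ennreal (C\<^sup>2) * ennreal ((cmod (g x))\<^sup>2)"
      by (simp add: ennreal_mult[symmetric] power_mult_distrib ennreal_leI)
  qed
  also have "\<dots> = ennreal (C\<^sup>2) * (\<integral>\<^sup>+x. ennreal ((cmod (g x))\<^sup>2) \<partial>M)"
    by (rule nn_integral_cmult) measurable
  finally show "(\<integral>\<^sup>+x. ennreal ((cmod (f x))\<^sup>2) \<partial>M) \<le> ennreal (C\<^sup>2) * (\<integral>\<^sup>+x. ennreal ((cmod (g x))\<^sup>2) \<partial>M)" .
qed

lemma L2_indicator: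
  assumes "A \<in> sets M" "emeasure M A < \<infinity>"
  shows "(indicator A :: 'a \<Rightarrow> complex) \<in> L2 M"
proof -
  have "(\<integral>\<^sup>+x. ennreal ((cmod (indicator A x :: complex))\<^sup>2) \<partial>M) = (\<integral>\<^sup>+x. indicator A x \<partial>M)"
    by (rule nn_integral_cong) (auto simp: indicator_def)
  then show ?thesis using assms by (simp add: L2_iff)
qed

lemma l2_norm_zero_AE_notin:
  assumes "f \<in> L2 M" "l2_norm M f = 0" "\<And>x. x \<in> A \<Longrightarrow> f x \<noteq> 0"
  shows "AE x in M. x \<notin> A"
  using l2_norm_zero_AE[OF assms(1,2)] by eventually_elim (use assms(3) in auto)

context sigma_finite_subalgebra
begin

text \<open>The set where E(g) vanishes lies in \<open>F\<close>, so the integral of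
  \<open>g\<close> over it is that of E(g), which is 0.\<close>

lemma nn_cond_exp_eq_zero:
  assumes [measurable]: "g \<in> borel_measurable M"
  shows "AE x in M. nn_cond_exp M F g x = 0 \<longrightarrow> g x = 0"
proof -
  define N where "N = {x \<in> space M. nn_cond_exp M F g x = 0}"
  have N [measurable]: "N \<in> sets F" unfolding N_def space_F[symmetric] by measurable
  have [measurable]: "N \<in> sets M" by (rule sets_F_imp_M[OF N])
  have "(\<integral>\<^sup>+x. indicator N x * g x \<partial>M) = (\<integral>\<^sup>+x. indicator N x * nn_cond_exp M F g x \<partial>M)"
    by (rule nn_cond_exp_intg[symmetric]) auto
  also have "\<dots> = (\<integral>\<^sup>+x. 0 \<partial>M)"
    by (rule nn_integral_cong) (auto simp: N_def indicator_def)
  finally have "AE x in M. indicator N x * g x = 0"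
    by (simp add: nn_integral_0_iff_AE)
  with AE_space show ?thesis
    by eventually_elim (auto simp: N_def)
qed

section \<open>Symbols normalised on a set\<close>

lemma cond_unit_on_outside:
  assumes "v \<in> cond_unit_on M F Z"
  shows "AE x in M. x \<notin> Z \<longrightarrow> v x = 0"
proof -
  have [measurable]: "v \<in> borel_measurable M"
    and E: "AE x in M. nn_cond_exp M F (\<lambda>y. ennreal ((cmod (v y))\<^sup>2)) x = indicator Z x"
    using assms by (auto simp: cond_unit_on_def)
  have "(\<lambda>y. ennreal ((cmod (v y))\<^sup>2)) \<in> borel_measurable M" by measurable
  from nn_cond_exp_eq_zero[OF this] E show ?thesis
    by eventually_elim (auto simp: ennreal_eq_0_iff)
qed

lemma cond_exp_c_cond_unit_on:
  assumes v: "v \<in> cond_unit_on M F Z"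
  shows "AE x in M. cond_exp_c M F (\<lambda>y. cnj (v y) * v y) x = indicator Z x"
    "AE x in M. cond_exp_c M F (\<lambda>y. v y * cnj (v y)) x = indicator Z x"
proof -
  have [measurable]: "v \<in> borel_measurable M"
    and E: "AE x in M. nn_cond_exp M F (\<lambda>y. ennreal ((cmod (v y))\<^sup>2)) x = indicator Z x"
    using v by (auto simp: cond_unit_on_def)
  have eq: "v y * cnj (v y) = of_real ((cmod (v y))\<^sup>2)" for y
    by (rule complex_norm_square[symmetric])
  have "AE x in M. cond_exp_c M F (\<lambda>y. of_real ((cmod (v y))\<^sup>2)) x
     = of_real (enn2real (nn_cond_exp M F (\<lambda>y. ennreal ((cmod (v y))\<^sup>2)) x))"
    by (rule cond_exp_c_of_real) auto
  with E have "AE x in M. cond_exp_c M F (\<lambda>y. of_real ((cmod (v y))\<^sup>2)) x = indicator Z x"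
    by eventually_elim (simp add: indicator_def)
  then show "AE x in M. cond_exp_c M F (\<lambda>y. v y * cnj (v y)) x = indicator Z x"
    "AE x in M. cond_exp_c M F (\<lambda>y. cnj (v y) * v y) x = indicator Z x"
    unfolding mult.commute[of "cnj _"] eq by auto
qed

lemma l2_norm_cond_unit_on:
  assumes v: "v \<in> cond_unit_on M F Z" and h: "h \<in> L2 M" and hF [measurable]: "h \<in> borel_measurable F"
    and supp: "\<And>x. x \<notin> Z \<Longrightarrow> h x = 0"
  shows "l2_norm M (\<lambda>x. v x * h x) = l2_norm M h"
proof -
  have [measurable]: "v \<in> borel_measurable M"
    and E: "AE x in M. nn_cond_exp M F (\<lambda>y. ennreal ((cmod (v y))\<^sup>2)) x = indicator Z x"
    using v by (auto simp: cond_unit_on_def)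
  have [measurable]: "h \<in> borel_measurable M" using h by measurable
  have "(\<integral>\<^sup>+x. ennreal ((cmod (v x * h x))\<^sup>2) \<partial>M)
      = (\<integral>\<^sup>+x. ennreal ((cmod (h x))\<^sup>2) * ennreal ((cmod (v x))\<^sup>2) \<partial>M)"
    by (simp add: norm_mult power_mult_distrib ennreal_mult mult.commute)
  also have "\<dots> = (\<integral>\<^sup>+x. ennreal ((cmod (h x))\<^sup>2) * nn_cond_exp M F (\<lambda>y. ennreal ((cmod (v y))\<^sup>2)) x \<partial>M)"
    by (rule nn_cond_exp_intg[symmetric]) auto
  also have "\<dots> = (\<integral>\<^sup>+x. ennreal ((cmod (h x))\<^sup>2) \<partial>M)"
    by (rule nn_integral_cong_AE) (use E in eventually_elim, use supp in \<open>auto simp: indicator_def\<close>)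
  finally have "ennreal ((l2_norm M (\<lambda>x. v x * h x))\<^sup>2) = ennreal ((l2_norm M h)\<^sup>2)"
    by (simp only: L2_nn_norm[OF h] L2_nn_norm[OF cond_unit_ball_F_mult_L2(1)[OF cond_unit_on_subset[OF v] h hF]])
  then show ?thesis by (simp add: power2_eq_iff_nonneg l2_norm_nonneg)
qed

lemma wop_coeff_cong:
  assumes "AE x in M. k x = k' x"
  shows "AE x in M. wop M F k z v f x = wop M F k' z v f x"
  using assms by eventually_elim (simp add: wop_def)

lemma wop_comp_coeff:
  assumes "l \<in> ess_bounded M F" "v \<in> cond_unit_ball M F" "y \<in> cond_unit_ball M F"
    "u \<in> cond_unit_ball M F" "f \<in> L2 M"
    and "AE x in M. k x * l x * cond_exp_c M F (\<lambda>t. v t * y t) x = m x"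
  shows "AE x in M. wop M F k z v (wop M F l y u f) x = wop M F m z u f x"
  using wop_comp[OF assms(1-5), of k z] wop_coeff_cong[OF assms(6), of z u f]
  by eventually_elim simp

text \<open>Duality turns the quadratic form into the integral of r |E(v f)|^2.\<close>

lemma wop_positive:
  assumes r: "(\<lambda>x. of_real (r x)) \<in> ess_bounded M F" and nonneg: "\<And>x. 0 \<le> r x"
    and v: "v \<in> cond_unit_ball M F"
  shows "positive_op M (wop M F (\<lambda>x. of_real (r x)) (\<lambda>x. cnj (v x)) v)"
  unfolding positive_op_def op_le_def
proof
  fix f assume f: "f \<in> L2 M"
  note [measurable] = ess_bounded_measurable[OF r]
  let ?e = "cond_exp_c M F (\<lambda>y. v y * f y)"
  have e: "cond_exp_c M F (\<lambda>y. cnj (v y) * cnj (f y)) x = cnj (?e x)" for x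
    using cond_exp_c_cnj[of "\<lambda>y. v y * f y" x] by simp
  have "l2_inner M (wop M F (\<lambda>x. of_real (r x)) (\<lambda>x. cnj (v x)) v f) f
      = (\<integral>x. (of_real (r x) * ?e x) * (cnj (v x) * cnj (f x)) \<partial>M)"
    by (simp add: l2_inner_def wop_def ac_simps)
  also have "\<dots> = (\<integral>x. (of_real (r x) * ?e x) * cond_exp_c M F (\<lambda>y. cnj (v y) * cnj (f y)) x \<partial>M)"
    by (rule cond_exp_c_duality[OF cond_unit_ball_cnj[OF v] L2_cnj[OF f], symmetric])
      (auto intro!: ess_bounded_mult_L2 r cond_exp_c_L2 v f)
  also have "\<dots> = (\<integral>x. of_real (r x * (cmod (?e x))\<^sup>2) \<partial>M)"
    unfolding e of_real_mult complex_norm_square mult.assoc ..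
  also have "\<dots> = of_real (\<integral>x. r x * (cmod (?e x))\<^sup>2 \<partial>M)"
    by (rule integral_complex_of_real)
  finally show "Im (l2_inner M (wop M F (\<lambda>x. of_real (r x)) (\<lambda>x. cnj (v x)) v f) f - l2_inner M (\<lambda>x. 0) f) = 0 \<and>
    0 \<le> Re (l2_inner M (wop M F (\<lambda>x. of_real (r x)) (\<lambda>x. cnj (v x)) v f) f - l2_inner M (\<lambda>x. 0) f)"
    by (simp add: l2_inner_def integral_nonneg nonneg)
qed

end

text \<open>The normal form of \<open>T\<close>. Positivity of \<open>k\<close> makes the square
  roots explicit, and \<open>k = 0\<close> off \<open>Z\<close> absorbs the factors
  \<open>indicator Z\<close> produced by E(|v|^2) and E(|z|^2).\<close>

locale weighted_cond_exp = sigma_finite_subalgebra +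
  fixes Z :: "'a set" and k :: "'a \<Rightarrow> real" and z v :: "'a \<Rightarrow> complex"
    and T :: "('a \<Rightarrow> complex) \<Rightarrow> 'a \<Rightarrow> complex"
  assumes Z [measurable]: "Z \<in> sets F"
    and z: "z \<in> cond_unit_on M F Z" and v: "v \<in> cond_unit_on M F Z"
    and k: "(\<lambda>x. of_real (k x)) \<in> ess_bounded M F"
    and k_pos: "\<And>x. x \<in> Z \<Longrightarrow> 0 < k x" and k_zero: "\<And>x. x \<notin> Z \<Longrightarrow> k x = 0"
    and T_bounded: "bounded_op M T"
    and T_eq: "\<And>f. f \<in> L2 M \<Longrightarrow> AE x in M. T f x = wop M F (\<lambda>x. of_real (k x)) z v f x"
    and T_quasi: "quasi_star_A M T"
begin

abbreviation "kc x \<equiv> complex_of_real (k x)"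
abbreviation "vc x \<equiv> cnj (v x)"
abbreviation "zc x \<equiv> cnj (z x)"

text \<open>The conditional inner product of \<open>z\<close> with \<open>cnj v\<close>: the scalar
  that appears each time \<open>T\<close> is composed with itself.\<close>

definition c where "c = cond_exp_c M F (\<lambda>y. v y * z y)"

definition S where "S = wop M F kc vc zc"

lemmas v_ball = cond_unit_on_subset[OF v]
lemmas z_ball = cond_unit_on_subset[OF z]
lemmas vc_ball = cond_unit_ball_cnj[OF v_ball]
lemmas zc_ball = cond_unit_ball_cnj[OF z_ball]

lemma Z_M [measurable]: "Z \<in> sets M" by (rule sets_F_imp_M[OF Z])

lemma kc_F [measurable]: "kc \<in> borel_measurable F" by (rule ess_bounded_measurable[OF k])

lemma k_F [measurable]: "k \<in> borel_measurable F"
  using kc_F by (simp add: borel_measurable_complex_iff)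

lemma k_M [measurable]: "k \<in> borel_measurable M" by (rule F_imp_M[OF k_F])

lemma v_M [measurable]: "v \<in> borel_measurable M" using v_ball by measurable
lemma z_M [measurable]: "z \<in> borel_measurable M" using z_ball by measurable

lemma c_F [measurable]: "c \<in> borel_measurable F" "c \<in> borel_measurable M"
  unfolding c_def by measurable

lemma c_bounded: "c \<in> ess_bounded M F" and c_le: "AE x in M. cmod (c x) \<le> 1"
  unfolding c_def using cond_exp_c_ess_bounded[OF v_ball z_ball] by auto

lemma k_nonneg: "0 \<le> k x"
  using k_pos[of x] k_zero[of x] by (cases "x \<in> Z") auto

lemma kc_indicator: "kc x * indicator Z x = kc x"
  using k_zero[of x] by (auto simp: indicator_def)

lemma E_zc_vc: "cond_exp_c M F (\<lambda>y. zc y * vc y) x = cnj (c x)"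
  unfolding c_def cond_exp_c_cnj[symmetric] by (simp add: mult.commute)

section \<open>The adjoint of \<open>T\<close> and its products with \<open>T\<close> in closed
  form\<close>

lemmas T_L2 = bounded_op_L2[OF T_bounded]

lemma S_adjoint: "is_adjoint M T S"
  using is_adjoint_cong[OF wop_adjoint[OF k z_ball v_ball] T_eq wop_L2[OF k z_ball v_ball] T_L2]
  by (simp add: S_def)

lemma S_L2: "f \<in> L2 M \<Longrightarrow> S f \<in> L2 M" by (rule is_adjoint_L2[OF S_adjoint])

lemma S_cong: "AE x in M. f x = g x \<Longrightarrow> f \<in> L2 M \<Longrightarrow> g \<in> L2 M \<Longrightarrow> AE x in M. S f x = S g x"
  unfolding S_def by (rule wop_cong) measurable

lemma T_cong:
  assumes "AE x in M. f x = wop M F l y v g x" "f \<in> L2 M" "wop M F l y v g \<in> L2 M"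
  shows "AE x in M. T f x = wop M F kc z v (wop M F l y v g) x"
  using T_eq[OF assms(2)] wop_cong[OF assms(1-3) v_M, of kc z] by eventually_elim simp

lemma kkc_bounded: "(\<lambda>x. kc x * kc x * c x) \<in> ess_bounded M F"
  by (intro ess_bounded_mult k c_bounded)

lemma T_T:
  assumes f: "f \<in> L2 M"
  shows "AE x in M. T (T f) x = wop M F (\<lambda>x. kc x * kc x * c x) z v f x"
proof -
  have "AE x in M. wop M F kc z v (wop M F kc z v f) x = wop M F (\<lambda>x. kc x * kc x * c x) z v f x"
    by (rule wop_comp_coeff[OF k v_ball z_ball v_ball f]) (simp add: c_def)
  with T_cong[OF T_eq[OF f] T_L2[OF f] wop_L2[OF k z_ball v_ball f]]
  show ?thesis by eventually_elim simp
qed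

lemma T_T_T:
  assumes f: "f \<in> L2 M"
  shows "AE x in M. T (T (T f)) x = wop M F (\<lambda>x. kc x * (kc x * kc x * c x) * c x) z v f x"
proof -
  have "AE x in M. wop M F kc z v (wop M F (\<lambda>x. kc x * kc x * c x) z v f) x
     = wop M F (\<lambda>x. kc x * (kc x * kc x * c x) * c x) z v f x"
    by (rule wop_comp_coeff[OF kkc_bounded v_ball z_ball v_ball f]) (simp add: c_def)
  with T_cong[OF T_T[OF f] T_L2[OF T_L2[OF f]] wop_L2[OF kkc_bounded z_ball v_ball f]]
  show ?thesis by eventually_elim simp
qed

lemma S_T:
  assumes f: "f \<in> L2 M"
  shows "AE x in M. S (T f) x = wop M F (\<lambda>x. kc x * kc x) vc v f x"
proof -
  have "AE x in M. S (wop M F kc z v f) x = wop M F (\<lambda>x. kc x * kc x) vc v f x"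
    unfolding S_def
    by (rule wop_comp_coeff[OF k zc_ball z_ball v_ball f])
      (use cond_exp_c_cond_unit_on(1)[OF z] in eventually_elim, simp add: mult.assoc kc_indicator)
  with S_cong[OF T_eq[OF f] T_L2[OF f] wop_L2[OF k z_ball v_ball f]]
  show ?thesis by eventually_elim simp
qed

lemma norm_inequality:
  assumes f: "f \<in> L2 M"
  shows "(l2_norm M (S (T f)))\<^sup>2 \<le> l2_norm M (T (T (T f))) * l2_norm M (T f)"
proof -
  \<comment> \<open>T S is k^2 z E(cnj z g) because E(|v|^2) = 1 on \<open>Z\<close>. Since E(|z|^2)
    = 1 there too, the positive root keeps the symbols and has coefficient \<open>k\<close>.\<close>
  define R1 where "R1 = wop M F kc z zc"
  \<comment> \<open>T^2 has coefficient k^2 c, so its adjoint times itself has coefficient k^4 |c|^2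
    with symbols \<open>cnj v\<close> and \<open>v\<close>; \<open>d\<close> is the root of that
    coefficient.\<close>
  define d where "d x = k x * k x * cmod (c x)" for x
  have d: "(\<lambda>x. complex_of_real (d x)) \<in> ess_bounded M F"
  proof -
    have "(\<lambda>x. complex_of_real (cmod (c x))) \<in> ess_bounded M F"
      using c_le by (auto simp: ess_bounded_def)
    from ess_bounded_mult[OF ess_bounded_mult[OF k k] this] show ?thesis
      by (simp add: d_def)
  qed
  define R2 where "R2 = wop M F (\<lambda>x. of_real (d x)) vc v"
  have R1: "bounded_op M R1" "positive_op M R1"
    unfolding R1_def using wop_bounded_op[OF k z_ball zc_ball] wop_positive[OF k k_nonneg zc_ball] by auto
  have R2: "bounded_op M R2" "positive_op M R2"
    unfolding R2_def using wop_bounded_op[OF d vc_ball v_ball] wop_positive[OF d _ v_ball]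
    by (auto simp: d_def)
  have sq1: "AE x in M. R1 (R1 g) x = T (S g) x" if g: "g \<in> L2 M" for g
  proof -
    have "AE x in M. R1 (R1 g) x = wop M F (\<lambda>x. kc x * kc x) z zc g x"
      unfolding R1_def
      by (rule wop_comp_coeff[OF k zc_ball z_ball zc_ball g])
        (use cond_exp_c_cond_unit_on(1)[OF z] in eventually_elim, simp add: mult.assoc kc_indicator)
    moreover have "AE x in M. wop M F kc z v (S g) x = wop M F (\<lambda>x. kc x * kc x) z zc g x"
      unfolding S_def
      by (rule wop_comp_coeff[OF k v_ball vc_ball zc_ball g])
        (use cond_exp_c_cond_unit_on(2)[OF v] in eventually_elim, simp add: mult.assoc kc_indicator)
    moreover note T_eq[OF S_L2[OF g]]
    ultimately show ?thesis by eventually_elim simp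
  qed
  have sq2: "AE x in M. R2 (R2 g) x = S (S (T (T g))) x" if g: "g \<in> L2 M" for g
  proof -
    let ?l = "\<lambda>x. kc x * (kc x * kc x * c x)"
    have l: "?l \<in> ess_bounded M F" by (intro ess_bounded_mult k c_bounded)
    have TT: "T (T g) \<in> L2 M" by (intro T_L2 g)
    have "AE x in M. S (wop M F (\<lambda>x. kc x * kc x * c x) z v g) x = wop M F ?l vc v g x"
      unfolding S_def
      by (rule wop_comp_coeff[OF kkc_bounded zc_ball z_ball v_ball g])
        (use cond_exp_c_cond_unit_on(1)[OF z] in eventually_elim, auto simp: indicator_def k_zero)
    with S_cong[OF T_T[OF g] TT wop_L2[OF kkc_bounded z_ball v_ball g]]
    have "AE x in M. S (T (T g)) x = wop M F ?l vc v g x" by eventually_elim simp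
    note S_cong[OF this S_L2[OF TT] wop_L2[OF l vc_ball v_ball g]]
    moreover have "AE x in M. S (wop M F ?l vc v g) x = wop M F (\<lambda>x. kc x * ?l x * cnj (c x)) vc v g x"
      unfolding S_def
      by (rule wop_comp_coeff[OF l zc_ball vc_ball v_ball g]) (simp add: E_zc_vc)
    moreover have "AE x in M. R2 (R2 g) x = wop M F (\<lambda>x. kc x * ?l x * cnj (c x)) vc v g x"
      unfolding R2_def
    proof (rule wop_comp_coeff[OF d v_ball vc_ball v_ball g], use cond_exp_c_cond_unit_on(2)[OF v] in eventually_elim)
      fix x assume "cond_exp_c M F (\<lambda>y. v y * vc y) x = indicator Z x"
      then have "complex_of_real (d x) * complex_of_real (d x) * cond_exp_c M F (\<lambda>y. v y * vc y) x
          = (kc x * indicator Z x) * kc x * kc x * kc x * of_real ((cmod (c x))\<^sup>2)"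
        by (simp add: d_def power2_eq_square ac_simps)
      also have "\<dots> = kc x * ?l x * cnj (c x)"
        unfolding kc_indicator complex_norm_square by (simp add: ac_simps)
      finally show "complex_of_real (d x) * complex_of_real (d x) * cond_exp_c M F (\<lambda>y. v y * vc y) x
          = kc x * ?l x * cnj (c x)" .
    qed
    ultimately show ?thesis by eventually_elim simp
  qed
  show ?thesis
    by (rule quasi_star_A_norm_le[OF T_bounded S_adjoint R1 sq1 R2 sq2 T_quasi f])
qed

text \<open>E(v f) = 1_A since \<open>A\<close> lies in \<open>Z\<close>. Each of the operators
  therefore sends \<open>f\<close> to its outer symbol times an \<open>F\<close>-measurable function
  on \<open>A\<close>, and the normalised outer symbol drops out of the norm.\<close>

lemma normalized_test_function:
  assumes A: "A \<in> sets F" and fin: "emeasure M A < \<infinity>" and AZ: "A \<subseteq> Z"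
  defines "f \<equiv> \<lambda>x. vc x * indicator A x"
  shows "f \<in> L2 M"
    "l2_norm M (T f) = l2_norm M (\<lambda>x. kc x * indicator A x)"
    "l2_norm M (S (T f)) = l2_norm M (\<lambda>x. kc x * kc x * indicator A x)"
    "l2_norm M (T (T (T f))) = l2_norm M (\<lambda>x. kc x * (kc x * kc x * c x) * c x * indicator A x)"
proof -
  note [measurable] = A
  have [measurable]: "A \<in> sets M" by (rule sets_F_imp_M[OF A])
  have ind: "(indicator A :: 'a \<Rightarrow> complex) \<in> L2 M" by (rule L2_indicator) (use fin in auto)
  show f: "f \<in> L2 M"
    unfolding f_def by (rule cond_unit_ball_F_mult_L2(1)[OF vc_ball ind]) measurable
  have vf: "(\<lambda>y. v y * f y) = (\<lambda>y. indicator A y * (v y * vc y))"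
    by (simp add: f_def ac_simps)
  have "(\<lambda>y. indicator A y * (v y * vc y)) \<in> dom_E M F"
    using cond_unit_ball_mult_L2_dom_E[OF v_ball f] unfolding vf .
  then have "AE x in M. cond_exp_c M F (\<lambda>y. indicator A y * (v y * vc y)) x
      = indicator A x * cond_exp_c M F (\<lambda>y. v y * vc y) x"
    by (intro cond_exp_c_mult) measurable
  with cond_exp_c_cond_unit_on(2)[OF v]
  have e: "AE x in M. cond_exp_c M F (\<lambda>y. v y * f y) x = indicator A x"
    unfolding vf by eventually_elim (use AZ in \<open>auto simp: indicator_def\<close>)
  have norm: "l2_norm M (wop M F l y v f) = l2_norm M (\<lambda>x. l x * indicator A x)"
    if l: "l \<in> ess_bounded M F" and y: "y \<in> cond_unit_on M F Z" for l y
  proof -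
    have lF [measurable]: "l \<in> borel_measurable F" by (rule ess_bounded_measurable[OF l])
    have [measurable]: "l \<in> borel_measurable M" by (rule F_imp_M[OF lF])
    have "AE x in M. wop M F l y v f x = y x * (l x * indicator A x)"
      unfolding wop_def using e by eventually_elim simp
    then have "l2_norm M (wop M F l y v f) = l2_norm M (\<lambda>x. y x * (l x * indicator A x))"
      by (rule l2_norm_cong)
        (use wop_L2[OF l cond_unit_on_subset[OF y] v_ball f] y in \<open>auto simp: cond_unit_on_def\<close>)
    also have "\<dots> = l2_norm M (\<lambda>x. l x * indicator A x)"
      by (rule l2_norm_cond_unit_on[OF y ess_bounded_mult_L2[OF l ind]])
        (measurable, use AZ in \<open>auto simp: indicator_def\<close>)
    finally show ?thesis .
  qed
  have eq: "l2_norm M g = l2_norm M (\<lambda>x. l x * indicator A x)"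
    if "AE x in M. g x = wop M F l y v f x" and "g \<in> L2 M"
      and l: "l \<in> ess_bounded M F" and y: "y \<in> cond_unit_on M F Z" for g l y
    using that wop_L2[OF l cond_unit_on_subset[OF y] v_ball f]
    by (subst norm[OF l y, symmetric], intro l2_norm_cong) auto
  show "l2_norm M (T f) = l2_norm M (\<lambda>x. kc x * indicator A x)"
    by (rule eq[OF T_eq[OF f] T_L2[OF f] k z])
  show "l2_norm M (S (T f)) = l2_norm M (\<lambda>x. kc x * kc x * indicator A x)"
    by (rule eq[OF S_T[OF f] S_L2[OF T_L2[OF f]] ess_bounded_mult[OF k k] cond_unit_on_cnj[OF v]])
  show "l2_norm M (T (T (T f))) = l2_norm M (\<lambda>x. kc x * (kc x * kc x * c x) * c x * indicator A x)"
    by (rule eq[OF T_T_T[OF f] T_L2[OF T_L2[OF T_L2[OF f]]] _ z]) (intro ess_bounded_mult k c_bounded)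
qed

text \<open>With \<open>A\<close> the set in question and \<open>N = \<parallel>k 1\<^sub>A\<parallel>\<close>, the norm inequality reads \<open>e\<^sup>2 N\<^sup>2 \<le> d\<^sup>2 N\<^sup>2\<close>.\<close>

lemma gap_set_null:
  assumes B: "B \<in> sets F" and fin: "emeasure M B < \<infinity>" and d: "0 \<le> d" and de: "d < e"
  shows "AE x in M. \<not> (x \<in> B \<inter> Z \<and> k x * cmod (c x) \<le> d \<and> e \<le> k x)"
proof -
  define A where "A = {x \<in> B \<inter> Z. k x * cmod (c x) \<le> d \<and> e \<le> k x}"
  note [measurable] = B
  have BM [measurable]: "B \<in> sets M" by (rule sets_F_imp_M[OF B])
  have A [measurable]: "A \<in> sets F" unfolding A_def by measurable
  have finA: "emeasure M A < \<infinity>"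
    using emeasure_mono[of A B M] fin by (auto simp: A_def intro: le_less_trans)
  have AZ: "A \<subseteq> Z" by (auto simp: A_def)
  note test = normalized_test_function[OF A finA AZ]
  have AM [measurable]: "A \<in> sets M" by (rule sets_F_imp_M[OF A])
  have ind: "(indicator A :: 'a \<Rightarrow> complex) \<in> L2 M" by (rule L2_indicator[OF AM finA])
  define N where "N = l2_norm M (\<lambda>x. kc x * indicator A x)"
  have L: "(\<lambda>x. kc x * indicator A x) \<in> L2 M"
    "(\<lambda>x. kc x * kc x * indicator A x) \<in> L2 M"
    "(\<lambda>x. kc x * (kc x * kc x * c x) * c x * indicator A x) \<in> L2 M"
    by (intro ess_bounded_mult_L2 ess_bounded_mult k c_bounded ind)+
  \<comment> \<open>On \<open>A\<close> the lower bound \<open>e\<close> for \<open>k\<close>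
    compares k with k^2 / e. Further down, the upper bound \<open>d\<close> for k |c| compares k^3
    |c|^2 with d^2 k.\<close>
  have "N \<le> (1 / e) * l2_norm M (\<lambda>x. kc x * kc x * indicator A x)"
    unfolding N_def
  proof (rule l2_norm_mono[OF L(1,2)])
    show "AE x in M. cmod (kc x * indicator A x) \<le> 1 / e * cmod (kc x * kc x * indicator A x)"
    proof (rule AE_I2)
      fix x
      have "e * k x \<le> k x * k x" if "x \<in> A"
        using that k_nonneg[of x] by (intro mult_right_mono) (auto simp: A_def)
      then show "cmod (kc x * indicator A x) \<le> 1 / e * cmod (kc x * kc x * indicator A x)"
        using d de k_nonneg[of x] by (auto simp: indicator_def norm_mult field_simps)
    qed
  qed (use d de in auto)
  then have "e * N \<le> l2_norm M (\<lambda>x. kc x * kc x * indicator A x)"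
    using d de by (simp add: field_simps)
  then have "(e * N)\<^sup>2 \<le> (l2_norm M (\<lambda>x. kc x * kc x * indicator A x))\<^sup>2"
    by (rule power_mono) (use d de in \<open>simp add: N_def l2_norm_nonneg\<close>)
  also have "\<dots> \<le> l2_norm M (\<lambda>x. kc x * (kc x * kc x * c x) * c x * indicator A x) * N"
    using norm_inequality[OF test(1)] unfolding test(2-4) N_def .
  also have "\<dots> \<le> (d\<^sup>2 * N) * N"
  proof (rule mult_right_mono)
    show "l2_norm M (\<lambda>x. kc x * (kc x * kc x * c x) * c x * indicator A x) \<le> d\<^sup>2 * N"
      unfolding N_def
    proof (rule l2_norm_mono[OF L(3,1)])
      show "AE x in M. cmod (kc x * (kc x * kc x * c x) * c x * indicator A x) \<le> d\<^sup>2 * cmod (kc x * indicator A x)"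
      proof (rule AE_I2)
        fix x
        have "(k x * cmod (c x))\<^sup>2 * k x \<le> d\<^sup>2 * k x" if "x \<in> A"
          using that k_nonneg[of x] by (intro mult_right_mono power_mono) (auto simp: A_def)
        then show "cmod (kc x * (kc x * kc x * c x) * c x * indicator A x) \<le> d\<^sup>2 * cmod (kc x * indicator A x)"
          using k_nonneg[of x] by (auto simp: indicator_def norm_mult power2_eq_square ac_simps)
      qed
    qed simp
  qed (simp add: N_def l2_norm_nonneg)
  finally have "e\<^sup>2 * N\<^sup>2 \<le> d\<^sup>2 * N\<^sup>2"
    by (simp add: power2_eq_square ac_simps)
  moreover have "d\<^sup>2 < e\<^sup>2" using d de by (intro power_strict_mono) auto
  ultimately have "N = 0"
    by (metis linorder_not_less mult_less_cancel_right zero_less_power2)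
  \<comment> \<open>\<open>k\<close> is positive on \<open>Z\<close>, so a vanishing norm of k 1_A
    forces \<open>A\<close> to be null.\<close>
  then have "AE x in M. x \<notin> A"
    unfolding N_def by (rule l2_norm_zero_AE_notin[OF L(1)]) (use AZ k_pos in force)
  then show ?thesis by (auto simp: A_def)
qed

text \<open>Cauchy-Schwarz bounds |c| by 1. A point of \<open>Z\<close> with |c| < 1 has k |c| < k,
  so it lies in a gap set for some rational d < e between these two values, and there are only
  countably many such null sets.\<close>

lemma cmod_c: "AE x in M. x \<in> Z \<longrightarrow> cmod (c x) = 1"
proof -
  obtain B :: "nat \<Rightarrow> 'a set" where B: "\<And>n. B n \<in> sets F" "\<And>n. emeasure M (B n) < \<infinity>"
    and cov: "space M \<subseteq> (\<Union>n. B n)"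
    using finite_exhaustion by blast
  have "AE x in M. \<forall>n. \<forall>d e :: rat. 0 \<le> d \<longrightarrow> d < e \<longrightarrow>
      \<not> (x \<in> B n \<inter> Z \<and> k x * cmod (c x) \<le> of_rat d \<and> of_rat e \<le> k x)"
    unfolding AE_all_countable
  proof (intro allI)
    fix n and d e :: rat
    show "AE x in M. 0 \<le> d \<longrightarrow> d < e \<longrightarrow>
      \<not> (x \<in> B n \<inter> Z \<and> k x * cmod (c x) \<le> of_rat d \<and> of_rat e \<le> k x)"
      using gap_set_null[OF B, of "of_rat d" "of_rat e" n]
      by (cases "0 \<le> d \<and> d < e") (auto simp: of_rat_less)
  qed
  with c_le AE_space show ?thesis
  proof eventually_elim
    case (elim x)
    show "x \<in> Z \<longrightarrow> cmod (c x) = 1"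
    proof (rule impI, rule ccontr)
      assume xZ: "x \<in> Z" and "cmod (c x) \<noteq> 1"
      then have "k x * cmod (c x) < k x * 1"
        using elim(1) k_pos[OF xZ] by (intro mult_strict_left_mono) auto
      then obtain d where d: "k x * cmod (c x) < of_rat d" "of_rat d < k x"
        using of_rat_dense by auto
      then obtain e where e: "(of_rat d :: real) < of_rat e" "of_rat e < k x"
        using of_rat_dense by blast
      have "0 \<le> k x * cmod (c x)" using k_nonneg by simp
      then have "0 < (of_rat d :: real)" using d by linarith
      then have "0 \<le> d" by simp
      moreover have "d < e" using e by (simp add: of_rat_less)
      moreover obtain n where "x \<in> B n" using elim(2) cov by blast
      ultimately show False using elim(3) d e xZ by (meson IntI less_imp_le)
    qed
  qed
qed

text \<open>The equality case of Cauchy-Schwarz, carried out in \<open>L2\<close> on pieces of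
  finite measure: z 1_A and c cnj v 1_A have the same norm N and inner product N^2, so their
  difference has norm 0.\<close>

lemma z_eq: "AE x in M. z x = c x * vc x"
proof -
  obtain B :: "nat \<Rightarrow> 'a set" where B: "\<And>n. B n \<in> sets F" "\<And>n. emeasure M (B n) < \<infinity>"
    and cov: "space M \<subseteq> (\<Union>n. B n)"
    using finite_exhaustion by blast
  note [measurable] = B(1)
  have BM [measurable]: "B n \<in> sets M" for n by (rule sets_F_imp_M[OF B(1)])
  have "AE x in M. x \<in> B n \<inter> Z \<longrightarrow> z x = c x * vc x" for n
  proof -
    define A where "A = B n \<inter> Z"
    have [measurable]: "A \<in> sets M" "A \<in> sets F" unfolding A_def by measurable
    have fin: "emeasure M A < \<infinity>"
      using emeasure_mono[of A "B n" M] B(2)[of n] by (auto simp: A_def intro: le_less_trans)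
    let ?I = "indicator A :: 'a \<Rightarrow> complex"
    define p where "p x = z x * ?I x" for x
    define q where "q x = vc x * (c x * ?I x)" for x
    have ind: "?I \<in> L2 M" by (rule L2_indicator[OF _ fin]) measurable
    have cind: "(\<lambda>x. c x * ?I x) \<in> L2 M" by (rule ess_bounded_mult_L2[OF c_bounded ind])
    have ccind: "(\<lambda>x. cnj (c x) * ?I x) \<in> L2 M"
      by (rule ess_bounded_mult_L2[OF ess_bounded_cnj[OF c_bounded] ind])
    have pL: "p \<in> L2 M" unfolding p_def by (rule cond_unit_ball_F_mult_L2(1)[OF z_ball ind]) measurable
    have qL: "q \<in> L2 M" unfolding q_def by (rule cond_unit_ball_F_mult_L2(1)[OF vc_ball cind]) measurable
    define N where "N = l2_norm M ?I"
    have Np: "l2_norm M p = N"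
      unfolding p_def N_def by (rule l2_norm_cond_unit_on[OF z ind]) (measurable, auto simp: A_def)
    have "l2_norm M q = l2_norm M (\<lambda>x. c x * ?I x)"
      unfolding q_def by (rule l2_norm_cond_unit_on[OF cond_unit_on_cnj[OF v] cind]) (measurable, auto simp: A_def)
    also have "\<dots> = N"
    proof -
      have "AE x in M. (cmod (c x * ?I x))\<^sup>2 = (cmod (?I x))\<^sup>2"
        using cmod_c by eventually_elim (auto simp: A_def indicator_def)
      then have "(\<integral>x. (cmod (c x * ?I x))\<^sup>2 \<partial>M) = (\<integral>x. (cmod (?I x))\<^sup>2 \<partial>M)"
        by (intro integral_cong_AE) auto
      then show ?thesis by (simp add: N_def l2_norm_def)
    qed
    finally have Nq: "l2_norm M q = N" .
    have "l2_inner M p q = (\<integral>x. (cnj (c x) * ?I x) * (v x * p x) \<partial>M)"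
      unfolding l2_inner_def q_def
      by (rule Bochner_Integration.integral_cong) (auto simp: indicator_def)
    also have "\<dots> = (\<integral>x. (cnj (c x) * ?I x) * cond_exp_c M F (\<lambda>y. v y * p y) x \<partial>M)"
      by (rule cond_exp_c_duality[OF v_ball pL ccind, symmetric]) measurable
    \<comment> \<open>E(v z 1_A) = c 1_A, and c cnj c = 1 on \<open>A\<close>.\<close>
    also have "\<dots> = (\<integral>x. ?I x * cnj (?I x) \<partial>M)"
    proof (rule integral_cong_AE)
      have vp: "(\<lambda>y. v y * p y) = (\<lambda>y. ?I y * (v y * z y))" by (simp add: p_def ac_simps)
      have "(\<lambda>y. ?I y * (v y * z y)) \<in> dom_E M F"
        using cond_unit_ball_mult_L2_dom_E[OF v_ball pL] unfolding vp .
      then have "AE x in M. cond_exp_c M F (\<lambda>y. ?I y * (v y * z y)) x = ?I x * c x"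
        unfolding c_def by (intro cond_exp_c_mult) measurable
      with cmod_c show "AE x in M. (cnj (c x) * ?I x) * cond_exp_c M F (\<lambda>y. v y * p y) x = ?I x * cnj (?I x)"
        unfolding vp
      proof eventually_elim
        case (elim x)
        have "c x * cnj (c x) = 1" if "x \<in> A"
          using elim(1) that by (simp add: A_def complex_norm_square[symmetric])
        then show ?case using elim(2) by (auto simp: indicator_def mult.commute)
      qed
    qed measurable
    also have "\<dots> = of_real (N\<^sup>2)"
      using l2_inner_self[OF ind] by (simp add: l2_inner_def N_def)
    finally have pq: "l2_inner M p q = of_real (N\<^sup>2)" .
    then have qp: "l2_inner M q p = of_real (N\<^sup>2)"
      using l2_inner_cnj[of M p q] by simp
    let ?d = "\<lambda>x. 1 * p x + (-1) * q x"
    have d: "?d \<in> L2 M" by (intro L2_add L2_scale pL qL)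
    have "l2_inner M ?d ?d = 0"
      unfolding l2_inner_add_left[OF pL qL d] l2_inner_add_right[OF pL qL pL] l2_inner_add_right[OF pL qL qL]
      by (simp add: l2_inner_self pL qL Np Nq pq qp)
    then have "l2_norm M ?d = 0" using l2_inner_self[OF d] by simp
    from l2_norm_zero_AE[OF d this] show ?thesis
      by eventually_elim (auto simp: p_def q_def A_def indicator_def)
  qed
  then have "AE x in M. \<forall>n. x \<in> B n \<inter> Z \<longrightarrow> z x = c x * vc x"
    unfolding AE_all_countable by blast
  \<comment> \<open>Off \<open>Z\<close> both \<open>z\<close> and \<open>v\<close> vanish almost
    everywhere, so both sides are 0 there.\<close>
  with AE_space cond_unit_on_outside[OF z] cond_unit_on_outside[OF v]
  show ?thesis
  proof eventually_elim
    case (elim x)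
    then show ?case using cov by (cases "x \<in> Z") auto
  qed
qed

text \<open>With e = E(v f), T f is k c cnj v e and the adjoint gives k cnj c cnj v e. Only the
  scalar k c has to be compared with \<open>a\<close>, which is done pointwise.\<close>

lemma eigenvector_adjoint:
  assumes f: "f \<in> L2 M" and eig: "AE x in M. T f x = a * f x"
  shows "AE x in M. adj M T f x = cnj a * f x"
proof -
  define e where "e = cond_exp_c M F (\<lambda>y. v y * f y)"
  have [measurable]: "e \<in> borel_measurable F" "e \<in> borel_measurable M" unfolding e_def by measurable
  have [measurable]: "f \<in> borel_measurable M" using f by measurable
  have vf: "(\<lambda>y. v y * f y) \<in> dom_E M F" by (rule cond_unit_ball_mult_L2_dom_E[OF v_ball f])
  have zf: "AE x in M. cond_exp_c M F (\<lambda>y. zc y * f y) x = cnj (c x) * e x"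
  proof -
    have ae: "AE x in M. zc x * f x = cnj (c x) * (v x * f x)"
      using z_eq by eventually_elim simp
    have "(\<lambda>x. zc x * f x) \<in> dom_E M F" by (rule cond_unit_ball_mult_L2_dom_E[OF zc_ball f])
    moreover have m: "(\<lambda>x. cnj (c x) * (v x * f x)) \<in> borel_measurable M" by measurable
    ultimately have dom: "(\<lambda>x. cnj (c x) * (v x * f x)) \<in> dom_E M F"
      by (rule dom_E_mono) (use ae in eventually_elim, metis order_refl)
    have "AE x in M. cond_exp_c M F (\<lambda>y. zc y * f y) x = cond_exp_c M F (\<lambda>x. cnj (c x) * (v x * f x)) x"
      by (rule cond_exp_c_cong[OF ae]) measurable
    moreover have "AE x in M. cond_exp_c M F (\<lambda>x. cnj (c x) * (v x * f x)) x = cnj (c x) * e x"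
      unfolding e_def by (rule cond_exp_c_mult[OF _ _ dom]) measurable
    ultimately show ?thesis by eventually_elim simp
  qed
  \<comment> \<open>Multiplying the eigenvalue equation by \<open>v\<close> and applying E gives a
    scalar equation for \<open>e\<close>, since E(v z) = c.\<close>
  have compress: "AE x in M. kc x * c x * e x = a * e x"
  proof -
    have dom: "(\<lambda>y. a * (v y * f y)) \<in> dom_E M F"
      using cond_unit_ball_mult_L2_dom_E[OF v_ball L2_scale[OF f, of a]] by (simp add: ac_simps)
    have ae: "AE x in M. (kc x * e x) * (v x * z x) = a * (v x * f x)"
      using T_eq[OF f] eig by eventually_elim (simp add: wop_def e_def ac_simps)
    have m: "(\<lambda>x. (kc x * e x) * (v x * z x)) \<in> borel_measurable M" by measurable
    have dom': "(\<lambda>x. (kc x * e x) * (v x * z x)) \<in> dom_E M F"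
      by (rule dom_E_mono[OF dom m]) (use ae in eventually_elim, metis order_refl)
    have "AE x in M. cond_exp_c M F (\<lambda>x. (kc x * e x) * (v x * z x)) x = (kc x * e x) * c x"
      unfolding c_def by (rule cond_exp_c_mult[OF _ _ dom']) measurable
    moreover have "AE x in M. cond_exp_c M F (\<lambda>x. (kc x * e x) * (v x * z x)) x = cond_exp_c M F (\<lambda>y. a * (v y * f y)) x"
      by (rule cond_exp_c_cong[OF ae]) measurable
    moreover have "AE x in M. cond_exp_c M F (\<lambda>y. a * (v y * f y)) x = a * e x"
      unfolding e_def by (rule cond_exp_c_mult[OF _ _ dom]) measurable
    ultimately show ?thesis by eventually_elim (simp add: ac_simps)
  qed
  have "AE x in M. adj M T f x = S f x"
    by (rule is_adjoint_unique[OF adj_is_adjoint[OF S_adjoint] S_adjoint f f _ T_L2]) simp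
  with T_eq[OF f] eig zf z_eq compress show ?thesis
  proof eventually_elim
    case (elim x)
    have eigx: "kc x * c x * vc x * e x = a * f x"
      using elim(1,2,4) by (simp add: wop_def e_def ac_simps)
    have Sx: "S f x = kc x * cnj (c x) * vc x * e x"
      using elim(3) by (simp add: S_def wop_def ac_simps)
    \<comment> \<open>For \<open>a = 0\<close>, replacing \<open>c\<close> by its conjugate keeps
      the product zero. For nonzero \<open>a\<close>, either e = 0, and then f = 0, or k c = a; in
      that case f = cnj v e, and k cnj c = cnj a because \<open>k\<close> is real.\<close>
    have "kc x * cnj (c x) * vc x * e x = cnj a * f x"
    proof (cases "a = 0")
      case True
      then show ?thesis using eigx by auto
    next
      case False
      show ?thesis
      proof (cases "e x = 0")
        case True
        then show ?thesis using eigx False by simp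
      next
        case False
        then have kc: "kc x * c x = a" using elim(5) by simp
        then have "a * (vc x * e x) = a * f x" using eigx by (simp add: ac_simps)
        then have "vc x * e x = f x" using \<open>a \<noteq> 0\<close> by simp
        moreover have "kc x * cnj (c x) = cnj a" unfolding kc[symmetric] by simp
        ultimately show ?thesis by (metis mult.assoc)
      qed
    qed
    then show ?case using elim(6) Sx by simp
  qed
qed

end

section \<open>Reduction to normalised symbols\<close>

context sigma_finite_subalgebra
begin

text \<open>Test on the part of \<open>B n\<close> where q < p. The bound on \<open>q\<close> makes
  its integral there finite, so the integral of p - q is a difference of integrals and
  vanishes.\<close>

lemma AE_le_of_nn_integral_le:
  assumes [measurable]: "p \<in> borel_measurable F" "q \<in> borel_measurable F"
    and bound: "AE x in M. q x \<le> ennreal L"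
    and le: "\<And>A. A \<in> sets F \<Longrightarrow> emeasure M A < \<infinity> \<Longrightarrow>
      (\<integral>\<^sup>+x. indicator A x * p x \<partial>M) \<le> (\<integral>\<^sup>+x. indicator A x * q x \<partial>M)"
  shows "AE x in M. p x \<le> q x"
proof -
  obtain B :: "nat \<Rightarrow> 'a set" where B: "\<And>n. B n \<in> sets F" "\<And>n. emeasure M (B n) < \<infinity>"
    and cov: "space M \<subseteq> (\<Union>n. B n)"
    using finite_exhaustion by blast
  note [measurable] = B(1)
  have [measurable]: "p \<in> borel_measurable M" "q \<in> borel_measurable M" by (rule F_imp_M; measurable)+
  have "AE x in M. x \<in> B n \<longrightarrow> p x \<le> q x" for n
  proof -
    define A where "A = {x \<in> B n. q x < p x}"
    have A [measurable]: "A \<in> sets F" unfolding A_def by measurable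
    have [measurable]: "A \<in> sets M" "B n \<in> sets M" using A B(1) by (auto intro: sets_F_imp_M)
    have fin: "emeasure M A < \<infinity>"
      using emeasure_mono[of A "B n" M] B(2)[of n] by (auto simp: A_def intro: le_less_trans)
    have "(\<integral>\<^sup>+x. indicator A x * q x \<partial>M) \<le> (\<integral>\<^sup>+x. ennreal L * indicator A x \<partial>M)"
      by (rule nn_integral_mono_AE) (use bound in eventually_elim, auto simp: indicator_def)
    also have "\<dots> < \<infinity>" using fin by (simp add: nn_integral_cmult ennreal_mult_less_top)
    finally have q: "(\<integral>\<^sup>+x. indicator A x * q x \<partial>M) < \<infinity>" .
    have "(\<integral>\<^sup>+x. indicator A x * p x - indicator A x * q x \<partial>M)
        = (\<integral>\<^sup>+x. indicator A x * p x \<partial>M) - (\<integral>\<^sup>+x. indicator A x * q x \<partial>M)"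
      by (rule nn_integral_diff) (use q in \<open>auto simp: indicator_def A_def\<close>)
    also have "\<dots> = 0" using le[OF A fin] q by (simp add: diff_eq_0_iff_ennreal le_less_trans)
    finally have "AE x in M. indicator A x * p x - indicator A x * q x = 0"
      by (simp add: nn_integral_0_iff_AE)
    with bound show ?thesis
    proof eventually_elim
      case (elim x)
      show ?case
      proof (rule impI, rule ccontr)
        assume "x \<in> B n" and *: "\<not> p x \<le> q x"
        then have "p x - q x = 0" using elim(2) by (simp add: A_def)
        moreover have "q x < top" using elim(1) by (auto intro: le_less_trans)
        ultimately show False using * by (auto simp: diff_eq_0_iff_ennreal)
      qed
    qed
  qed
  then have "AE x in M. \<forall>n. x \<in> B n \<longrightarrow> p x \<le> q x" unfolding AE_all_countable by blast
  with AE_space show ?thesis by eventually_elim (use cov in blast)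
qed

text \<open>Testing on cnj u, truncated and restricted to A in \<open>F\<close>, bounds the integral
  of a_n^2 b over A by K^2 times that of a_n, where a_n and b are the conditional expectations of
  the truncated |u|^2 and of |w|^2. Hence a_n b is at most K^2, and letting n grow bounds a
  b.\<close>

lemma wce_op_symbol_bound:
  assumes u [measurable]: "u \<in> borel_measurable M" and w [measurable]: "w \<in> borel_measurable M"
    and T: "bounded_op M (wce_op M F w u)"
  shows "\<exists>C. AE x in M. nn_cond_exp M F (\<lambda>y. ennreal ((cmod (u y))\<^sup>2)) x
    * nn_cond_exp M F (\<lambda>y. ennreal ((cmod (w y))\<^sup>2)) x \<le> ennreal C"
proof -
  obtain K0 where K0: "\<And>f. f \<in> L2 M \<Longrightarrow> l2_norm M (wce_op M F w u f) \<le> K0 * l2_norm M f"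
    using T unfolding bounded_op_def by blast
  define K where "K = \<bar>K0\<bar>"
  have K: "(\<integral>\<^sup>+x. ennreal ((cmod (wce_op M F w u f x))\<^sup>2) \<partial>M)
      \<le> ennreal (K\<^sup>2) * (\<integral>\<^sup>+x. ennreal ((cmod (f x))\<^sup>2) \<partial>M)" if f: "f \<in> L2 M" for f
  proof -
    have "l2_norm M (wce_op M F w u f) \<le> K * l2_norm M f"
      using K0[OF f] mult_right_mono[OF abs_ge_self[of K0] l2_norm_nonneg[of M f]]
      unfolding K_def by linarith
    from power_mono[OF this l2_norm_nonneg, of 2] show ?thesis
      by (simp add: L2_nn_norm f bounded_op_L2[OF T f] ennreal_mult[symmetric] power_mult_distrib ennreal_leI)
  qed
  define a where "a = nn_cond_exp M F (\<lambda>y. ennreal ((cmod (u y))\<^sup>2))"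
  define b where "b = nn_cond_exp M F (\<lambda>y. ennreal ((cmod (w y))\<^sup>2))"
  \<comment> \<open>\<open>cnj u\<close> cut off to a set of finite measure need not be in L2, so it is truncated at height \<open>n\<close>.\<close>
  define r where "r n y = (cmod (u y))\<^sup>2 * indicator {y. cmod (u y) \<le> real n} y" for n y
  define an where "an n = nn_cond_exp M F (\<lambda>y. ennreal (r n y))" for n
  have r [measurable]: "r n \<in> borel_measurable M" for n unfolding r_def by measurable
  have r_nonneg: "0 \<le> r n x" for n x by (simp add: r_def)
  have r_le: "r n x \<le> (real n)\<^sup>2" for n x
    by (auto simp: r_def indicator_def intro: power_mono)
  have [measurable]: "a \<in> borel_measurable F" "b \<in> borel_measurable F" "an n \<in> borel_measurable F"
    "a \<in> borel_measurable M" "b \<in> borel_measurable M" "an n \<in> borel_measurable M" for n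
    by (simp_all add: a_def b_def an_def)
  have an_le: "AE x in M. an n x \<le> ennreal ((real n)\<^sup>2)" for n
  proof -
    have "AE x in M. an n x \<le> nn_cond_exp M F (\<lambda>_. ennreal ((real n)\<^sup>2)) x"
      unfolding an_def by (rule nn_cond_exp_mono) (auto intro: ennreal_leI r_le)
    moreover have "AE x in M. ennreal ((real n)\<^sup>2) = nn_cond_exp M F (\<lambda>_. ennreal ((real n)\<^sup>2)) x"
      by (rule nn_cond_exp_F_meas) simp
    ultimately show ?thesis by eventually_elim simp
  qed
  have test: "(\<integral>\<^sup>+x. indicator A x * ((an n x)\<^sup>2 * b x) \<partial>M) \<le> (\<integral>\<^sup>+x. indicator A x * (ennreal (K\<^sup>2) * an n x) \<partial>M)"
    if A [measurable]: "A \<in> sets F" and fin: "emeasure M A < \<infinity>" for A n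
  proof -
    have AM [measurable]: "A \<in> sets M" by (rule sets_F_imp_M[OF A])
    define f where "f y = cnj (u y) * indicator {y. cmod (u y) \<le> real n} y * indicator A y" for y
    have f: "f \<in> L2 M"
    proof (rule L2_dominated[OF L2_indicator[OF AM fin], of _ "real n"])
      show "f \<in> borel_measurable M" unfolding f_def by measurable
      show "AE x in M. cmod (f x) \<le> real n * cmod (indicator A x)"
        by (auto simp: f_def indicator_def norm_mult)
    qed
    have uf: "(\<lambda>y. u y * f y) = (\<lambda>y. of_real (indicator A y * r n y))"
      by (rule ext) (auto simp: f_def r_def indicator_def complex_norm_square[symmetric])
    have "AE x in M. cond_exp_c M F (\<lambda>y. u y * f y) x
      = of_real (enn2real (nn_cond_exp M F (\<lambda>y. ennreal (indicator A y * r n y)) x))"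
      unfolding uf by (rule cond_exp_c_of_real) (auto simp: r_nonneg)
    moreover have "AE x in M. indicator A x * an n x = nn_cond_exp M F (\<lambda>y. indicator A y * ennreal (r n y)) x"
      unfolding an_def by (rule nn_cond_exp_prod) auto
    moreover have "(\<lambda>y. indicator A y * ennreal (r n y)) = (\<lambda>y. ennreal (indicator A y * r n y))"
      by (auto simp: indicator_def)
    ultimately have e: "AE x in M. cond_exp_c M F (\<lambda>y. u y * f y) x = of_real (enn2real (indicator A x * an n x))"
      by (auto elim: eventually_elim2)
    have "(\<integral>\<^sup>+x. indicator A x * ((an n x)\<^sup>2 * b x) \<partial>M) = (\<integral>\<^sup>+x. (indicator A x * (an n x)\<^sup>2) * b x \<partial>M)"
      by (simp add: mult.assoc)
    also have "\<dots> = (\<integral>\<^sup>+x. (indicator A x * (an n x)\<^sup>2) * ennreal ((cmod (w x))\<^sup>2) \<partial>M)"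
      unfolding b_def by (rule nn_cond_exp_intg) auto
    also have "\<dots> = (\<integral>\<^sup>+x. ennreal ((cmod (wce_op M F w u f x))\<^sup>2) \<partial>M)"
    proof (rule nn_integral_cong_AE, use e an_le[of n] in eventually_elim)
      fix x assume e: "cond_exp_c M F (\<lambda>y. u y * f y) x = of_real (enn2real (indicator A x * an n x))"
        and "an n x \<le> ennreal ((real n)\<^sup>2)"
      then have "an n x < top" by (auto intro: le_less_trans)
      then obtain t where t: "0 \<le> t" "an n x = ennreal t" by (cases "an n x") auto
      show "(indicator A x * (an n x)\<^sup>2) * ennreal ((cmod (w x))\<^sup>2) = ennreal ((cmod (wce_op M F w u f x))\<^sup>2)"
        using t unfolding wce_op_def e mult.commute[of "w x"]
        by (auto simp: indicator_def norm_mult power_mult_distrib ennreal_mult ennreal_power)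
    qed
    also have "\<dots> \<le> ennreal (K\<^sup>2) * (\<integral>\<^sup>+x. ennreal ((cmod (f x))\<^sup>2) \<partial>M)" by (rule K[OF f])
    also have "(\<integral>\<^sup>+x. ennreal ((cmod (f x))\<^sup>2) \<partial>M) = (\<integral>\<^sup>+x. indicator A x * ennreal (r n x) \<partial>M)"
      by (rule nn_integral_cong) (auto simp: f_def r_def indicator_def)
    also have "\<dots> = (\<integral>\<^sup>+x. indicator A x * an n x \<partial>M)"
      unfolding an_def by (rule nn_cond_exp_intg[symmetric]) auto
    also have "ennreal (K\<^sup>2) * \<dots> = (\<integral>\<^sup>+x. ennreal (K\<^sup>2) * (indicator A x * an n x) \<partial>M)"
      by (rule nn_integral_cmult[symmetric]) measurable
    also have "\<dots> = (\<integral>\<^sup>+x. indicator A x * (ennreal (K\<^sup>2) * an n x) \<partial>M)" by (simp add: ac_simps)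
    finally show ?thesis .
  qed
  \<comment> \<open>From a_n^2 b at most K^2 a_n one factor a_n cancels where it is nonzero, being
    finite by truncation. Where a_n = 0 the product is 0, even for infinite b.\<close>
  have trunc: "AE x in M. b x * an n x \<le> ennreal (K\<^sup>2)" for n
  proof -
    have "AE x in M. ennreal (K\<^sup>2) * an n x \<le> ennreal (K\<^sup>2 * (real n)\<^sup>2)"
      using an_le[of n] by eventually_elim (simp add: ennreal_mult mult_left_mono)
    moreover have "(\<lambda>x. (an n x)\<^sup>2 * b x) \<in> borel_measurable F"
      "(\<lambda>x. ennreal (K\<^sup>2) * an n x) \<in> borel_measurable F"
      by measurable
    ultimately have "AE x in M. (an n x)\<^sup>2 * b x \<le> ennreal (K\<^sup>2) * an n x"
      using AE_le_of_nn_integral_le test by blast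
    with an_le[of n] show ?thesis
    proof eventually_elim
      case (elim x)
      show ?case
      proof (cases "an n x = 0")
        case False
        moreover have "an n x \<noteq> top" using elim(1) by (auto simp: top_unique)
        moreover have "an n x * (b x * an n x) \<le> an n x * ennreal (K\<^sup>2)"
          using elim(2) by (simp add: power2_eq_square ac_simps)
        ultimately show ?thesis by (simp add: ennreal_mult_le_mult_iff)
      qed simp
    qed
  qed
  have full: "(\<integral>\<^sup>+x. indicator A x * (a x * b x) \<partial>M) \<le> (\<integral>\<^sup>+x. indicator A x * ennreal (K\<^sup>2) \<partial>M)"
    if A [measurable]: "A \<in> sets F" for A
  proof -
    have AM [measurable]: "A \<in> sets M" by (rule sets_F_imp_M[OF A])
    have "(\<integral>\<^sup>+x. indicator A x * (a x * b x) \<partial>M) = (\<integral>\<^sup>+x. (indicator A x * b x) * a x \<partial>M)"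
      by (simp add: ac_simps)
    also have "\<dots> = (\<integral>\<^sup>+x. (indicator A x * b x) * ennreal ((cmod (u x))\<^sup>2) \<partial>M)"
      unfolding a_def by (rule nn_cond_exp_intg) auto
    \<comment> \<open>|u|^2 is the increasing supremum of its truncations, so monotone convergence
      carries the bound to the limit.\<close>
    also have "\<dots> = (\<integral>\<^sup>+x. (SUP n. (indicator A x * b x) * ennreal (r n x)) \<partial>M)"
    proof (rule nn_integral_cong)
      fix x
      obtain m where m: "cmod (u x) \<le> real m" using real_arch_simple by blast
      have "(SUP n. ennreal (r n x)) = ennreal ((cmod (u x))\<^sup>2)"
      proof (rule antisym)
        show "(SUP n. ennreal (r n x)) \<le> ennreal ((cmod (u x))\<^sup>2)"
          by (rule SUP_least) (auto simp: r_def indicator_def)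
        show "ennreal ((cmod (u x))\<^sup>2) \<le> (SUP n. ennreal (r n x))"
          by (rule SUP_upper2[of m]) (use m in \<open>auto simp: r_def\<close>)
      qed
      then show "(indicator A x * b x) * ennreal ((cmod (u x))\<^sup>2) = (SUP n. (indicator A x * b x) * ennreal (r n x))"
        by (simp add: SUP_mult_left_ennreal[symmetric])
    qed
    also have "\<dots> = (SUP n. \<integral>\<^sup>+x. (indicator A x * b x) * ennreal (r n x) \<partial>M)"
    proof (rule nn_integral_monotone_convergence_SUP)
      show "incseq (\<lambda>n x. (indicator A x * b x) * ennreal (r n x))"
        by (auto simp: incseq_def le_fun_def r_def indicator_def intro!: mult_left_mono)
    qed measurable
    also have "\<dots> \<le> (\<integral>\<^sup>+x. indicator A x * ennreal (K\<^sup>2) \<partial>M)"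
    proof (rule SUP_least)
      fix n
      have "(\<integral>\<^sup>+x. (indicator A x * b x) * ennreal (r n x) \<partial>M) = (\<integral>\<^sup>+x. (indicator A x * b x) * an n x \<partial>M)"
        unfolding an_def by (rule nn_cond_exp_intg[symmetric]) auto
      also have "\<dots> \<le> (\<integral>\<^sup>+x. indicator A x * ennreal (K\<^sup>2) \<partial>M)"
        by (rule nn_integral_mono_AE) (use trunc[of n] in eventually_elim, simp add: mult.assoc mult_left_mono)
      finally show "(\<integral>\<^sup>+x. (indicator A x * b x) * ennreal (r n x) \<partial>M) \<le> (\<integral>\<^sup>+x. indicator A x * ennreal (K\<^sup>2) \<partial>M)" .
    qed
    finally show ?thesis .
  qed
  have "AE x in M. a x * b x \<le> ennreal (K\<^sup>2)"
    by (rule AE_le_of_nn_integral_le[of _ _ "K\<^sup>2"]) (use full in auto)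
  then show ?thesis unfolding a_def b_def by blast
qed

text \<open>The factor is \<open>F\<close>-measurable, so its square 1/a pulls out of E(|g|^2);
  positivity and finiteness of \<open>a\<close> on \<open>Z\<close> make the product exactly
  1.\<close>

lemma normalize_cond_unit_on:
  assumes g [measurable]: "g \<in> borel_measurable M" and Z [measurable]: "Z \<in> sets F"
  defines "a \<equiv> nn_cond_exp M F (\<lambda>y. ennreal ((cmod (g y))\<^sup>2))"
  assumes pos: "\<And>x. x \<in> Z \<Longrightarrow> 0 < a x \<and> a x < \<infinity>"
  shows "(\<lambda>x. of_real (indicator Z x / sqrt (enn2real (a x))) * g x) \<in> cond_unit_on M F Z"
proof -
  have [measurable]: "a \<in> borel_measurable F" "a \<in> borel_measurable M" by (simp_all add: a_def)
  have [measurable]: "Z \<in> sets M" by (rule sets_F_imp_M[OF Z])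
  have "AE x in M. ennreal (indicator Z x / enn2real (a x)) * a x
      = nn_cond_exp M F (\<lambda>y. ennreal (indicator Z y / enn2real (a y)) * ennreal ((cmod (g y))\<^sup>2)) x"
    unfolding a_def[symmetric] by (subst (2) a_def, rule nn_cond_exp_prod) auto
  moreover have "ennreal ((cmod (of_real (indicator Z y / sqrt (enn2real (a y))) * g y))\<^sup>2)
      = ennreal (indicator Z y / enn2real (a y)) * ennreal ((cmod (g y))\<^sup>2)" for y
    by (auto simp: norm_mult norm_divide power_mult_distrib power_divide indicator_def ennreal_mult[symmetric])
  moreover have "ennreal (indicator Z x / enn2real (a x)) * a x = indicator Z x" for x
  proof (cases "x \<in> Z")
    case True
    then obtain t where t: "0 < t" "a x = ennreal t"
      using pos[OF True] by (cases "a x") (auto simp: ennreal_zero_less_top)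
    then show ?thesis using True by (simp add: ennreal_mult[symmetric])
  qed simp
  ultimately show ?thesis by (auto simp: cond_unit_on_def eq_commute)
qed

text \<open>On \<open>Z\<close> the normalising factors cancel against \<open>k\<close>. Off
  \<open>Z\<close> the bound on E(|u|^2) E(|w|^2) forces one of the two to vanish, and then T f
  vanishes.\<close>

lemma wce_op_normal_form:
  assumes u [measurable]: "u \<in> borel_measurable M" and w [measurable]: "w \<in> borel_measurable M"
    and T: "bounded_op M (wce_op M F w u)" and quasi: "quasi_star_A M (wce_op M F w u)"
  shows "\<exists>Z k z v. weighted_cond_exp M F Z k z v (wce_op M F w u)"
proof -
  define a where "a = nn_cond_exp M F (\<lambda>y. ennreal ((cmod (u y))\<^sup>2))"
  define b where "b = nn_cond_exp M F (\<lambda>y. ennreal ((cmod (w y))\<^sup>2))"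
  have [measurable]: "a \<in> borel_measurable F" "b \<in> borel_measurable F"
    "a \<in> borel_measurable M" "b \<in> borel_measurable M"
    by (simp_all add: a_def b_def)
  obtain C where C: "AE x in M. a x * b x \<le> ennreal C"
    using wce_op_symbol_bound[OF u w T] unfolding a_def b_def by blast
  define Z where "Z = {x \<in> space M. 0 < a x \<and> a x < \<infinity> \<and> 0 < b x \<and> b x < \<infinity>}"
  have Z [measurable]: "Z \<in> sets F" unfolding Z_def space_F[symmetric] by measurable
  have ZM [measurable]: "Z \<in> sets M" by (rule sets_F_imp_M[OF Z])
  define k where "k x = indicator Z x * (sqrt (enn2real (a x)) * sqrt (enn2real (b x)))" for x
  define s where "s x = complex_of_real (indicator Z x / sqrt (enn2real (a x)))" for x
  define v where "v x = s x * u x" for x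
  define z where "z x = of_real (indicator Z x / sqrt (enn2real (b x))) * w x" for x
  have [measurable]: "s \<in> borel_measurable F" unfolding s_def by measurable
  have v: "v \<in> cond_unit_on M F Z"
    unfolding v_def s_def a_def by (rule normalize_cond_unit_on[OF u Z]) (auto simp: Z_def a_def)
  have z: "z \<in> cond_unit_on M F Z"
    unfolding z_def b_def by (rule normalize_cond_unit_on[OF w Z]) (auto simp: Z_def b_def)
  have pos: "0 < enn2real (a x)" "0 < enn2real (b x)" if "x \<in> Z" for x
    using that by (auto simp: Z_def enn2real_positive_iff)
  have k: "(\<lambda>x. complex_of_real (k x)) \<in> ess_bounded M F"
  proof -
    \<comment> \<open>\<open>ennreal\<close> sends a negative \<open>C\<close> to 0, which the
      maximum reproduces on the real side.\<close>
    have "AE x in M. cmod (complex_of_real (k x)) \<le> sqrt (max C 0)"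
      using C
    proof eventually_elim
      case (elim x)
      show ?case
      proof (cases "x \<in> Z")
        case True
        have "enn2real (a x * b x) \<le> enn2real (ennreal C)"
          by (rule enn2real_mono[OF elim]) simp
        then have "sqrt (enn2real (a x * b x)) \<le> sqrt (max C 0)"
          by (cases "0 \<le> C") (auto simp: ennreal_neg)
        then show ?thesis using True pos[OF True]
          by (simp add: k_def real_sqrt_mult enn2real_mult norm_mult)
      qed (simp add: k_def)
    qed
    then show ?thesis unfolding ess_bounded_def k_def by auto
  qed
  have eq: "AE x in M. wce_op M F w u f x = wop M F (\<lambda>x. of_real (k x)) z v f x" if f: "f \<in> L2 M" for f
  proof -
    have [measurable]: "f \<in> borel_measurable M" using f by measurable
    have "(\<lambda>x. v x * f x) \<in> dom_E M F" by (rule cond_unit_ball_mult_L2_dom_E[OF cond_unit_on_subset[OF v] f])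
    then have dom: "(\<lambda>x. s x * (u x * f x)) \<in> dom_E M F" by (simp add: v_def mult.assoc)
    have on_Z: "AE x in M. cond_exp_c M F (\<lambda>x. v x * f x) x = s x * cond_exp_c M F (\<lambda>x. u x * f x) x"
      unfolding v_def mult.assoc by (rule cond_exp_c_mult[OF _ _ dom]) measurable
    \<comment> \<open>On \<open>N\<close> the symbol \<open>u\<close> vanishes almost everywhere. As
      \<open>N\<close> lies in \<open>F\<close>, its indicator passes through E, so E(u f) vanishes
      on \<open>N\<close>.\<close>
    define N where "N = {x \<in> space M. a x = 0}"
    have N [measurable]: "N \<in> sets F" unfolding N_def space_F[symmetric] by measurable
    have [measurable]: "N \<in> sets M" by (rule sets_F_imp_M[OF N])
    have "(\<lambda>x. ennreal ((cmod (u x))\<^sup>2)) \<in> borel_measurable M"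
      "(\<lambda>x. ennreal ((cmod (w x))\<^sup>2)) \<in> borel_measurable M" by measurable
    from this[THEN nn_cond_exp_eq_zero]
    have u0: "AE x in M. a x = 0 \<longrightarrow> u x = 0" and w0: "AE x in M. b x = 0 \<longrightarrow> w x = 0"
      by (simp_all add: a_def b_def ennreal_eq_0_iff)
    have ae: "AE x in M. indicator N x * (u x * f x) = 0 * (u x * f x)"
      using u0 by eventually_elim (auto simp: N_def indicator_def)
    \<comment> \<open>The zero function is written as \<open>0 * (u x * f x)\<close> so that pulling
      out the factor 0 shows its conditional expectation to be 0.\<close>
    have dom0: "(\<lambda>x. 0 * (u x * f x)) \<in> dom_E M F"
      by (rule dom_E_mono[OF dom]) auto
    have m: "(\<lambda>x. indicator N x * (u x * f x)) \<in> borel_measurable M" by measurable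
    have domN: "(\<lambda>x. indicator N x * (u x * f x)) \<in> dom_E M F"
      by (rule dom_E_mono[OF dom0 m]) (use ae in eventually_elim, simp)
    have "AE x in M. cond_exp_c M F (\<lambda>x. indicator N x * (u x * f x)) x = indicator N x * cond_exp_c M F (\<lambda>x. u x * f x) x"
      by (rule cond_exp_c_mult[OF _ _ domN]) measurable
    moreover have "AE x in M. cond_exp_c M F (\<lambda>x. 0 * (u x * f x)) x = 0 * cond_exp_c M F (\<lambda>x. u x * f x) x"
      by (rule cond_exp_c_mult[OF _ _ dom0]) measurable
    moreover have "AE x in M. cond_exp_c M F (\<lambda>x. indicator N x * (u x * f x)) x = cond_exp_c M F (\<lambda>x. 0 * (u x * f x)) x"
      by (rule cond_exp_c_cong[OF ae m]) measurable
    ultimately have on_N: "AE x in M. indicator N x * cond_exp_c M F (\<lambda>x. u x * f x) x = 0"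
      by eventually_elim simp
    from AE_space C on_Z on_N w0 show ?thesis
    proof eventually_elim
      case (elim x)
      show ?case
      proof (cases "x \<in> Z")
        case True
        then show ?thesis using pos[OF True]
          by (simp add: wce_op_def wop_def elim(3) s_def z_def k_def)
      next
        case False
        \<comment> \<open>If neither vanished, lying outside \<open>Z\<close> would make one of them
          infinite and hence the product infinite, against the bound \<open>C\<close>.\<close>
        have "a x = 0 \<or> b x = 0"
        proof (rule ccontr)
          assume *: "\<not> (a x = 0 \<or> b x = 0)"
          then have "a x = top \<or> b x = top"
            using False elim(1) by (auto simp: Z_def zero_less_iff_neq_zero simp flip: top.not_eq_extremum)
          then have "a x * b x = top" using * by (auto simp: ennreal_top_mult ennreal_mult_top)
          then show False using elim(2) by (simp add: top_unique)
        qed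
        then have "wce_op M F w u f x = 0"
          using elim(1,4,5) by (auto simp: wce_op_def N_def)
        then show ?thesis using False by (simp add: wop_def k_def)
      qed
    qed
  qed
  have "weighted_cond_exp M F Z k z v (wce_op M F w u)"
    by unfold_locales (use Z z v k T quasi eq pos in \<open>auto simp: k_def\<close>)
  then show ?thesis by blast
qed

end

theorem theorem3p4:
  fixes M F :: "'a measure" and u w :: "'a \<Rightarrow> complex"
  assumes "complete_measure M" and "sigma_finite_measure M"
    and "sigma_finite_subalgebra M F"
    and "u \<in> dom_E M F" and "w \<in> dom_E M F"
    and "\<forall>f\<in>L2 M. (\<lambda>x. u x * f x) \<in> dom_E M F"
    and "bounded_op M (wce_op M F w u)"
    and "quasi_star_A M (wce_op M F w u)"
  shows "point_spectrum M (wce_op M F w u) = joint_point_spectrum M (wce_op M F w u)"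
proof -
  interpret sigma_finite_subalgebra M F by fact
  have "u \<in> borel_measurable M" "w \<in> borel_measurable M"
    using assms(4,5) by (auto simp: dom_E_def)
  then obtain Z k z v where "weighted_cond_exp M F Z k z v (wce_op M F w u)"
    using wce_op_normal_form assms(7,8) by blast
  then interpret weighted_cond_exp M F Z k z v "wce_op M F w u" .
  \<comment> \<open>One inclusion holds by definition; for the other, the given eigenvector itself
    satisfies the adjoint equation.\<close>
  show ?thesis
    unfolding point_spectrum_def joint_point_spectrum_def ae_eq_def
    using eigenvector_adjoint by blast
qed

end
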